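(* Let $n=2$. For every constant $c\ge0$ there is a function $f_c\in C^\infty((0,1])$, positive on $(0,1)$, with $f_c(1)=0$, $f_c'(1)=-1$, such that $f=f_c$ satisfies $$ t f'\bigl(ff'+tff''-t(f')^2\bigr)=1\qquad\text{on }(0,1), $$ $$ -\frac{t}{f(t)^3}+\frac{t^2f'(t)^2}{2f(t)^2}-\frac{t^3f'(t)^3}{f(t)^3}=c\qquad\text{for all }t\in(0,1), $$ and such that $u_c(z):=f_c(|z|^2)$ gives rise to a Poincaré metric $\partial\overline\partial\log\frac1{u_c}$ on $\mathbf M^2$, with $u_c$ smooth up to the outer boundary $|z|=1$.
   Context: Kepler manifold and its unit ball: $\mathbf H^n:=\{z\in\mathbf C^{n+1}: z\cdot z=0,\ z\ne0\}$, where $z\cdot w=\sum_j z_jw_j$; it is an $n$-dimensional complex submanifold of $\mathbf C^{n+1}$. $\mathbf M^n:=\{z\in\mathbf H^n:|z|<1\}$, with outer boundary $\partial\mathbf M^n=\{z\in\mathbf H^n:|z|=1\}$. A positive smooth function $u$ on $\mathbf M^n$, with $\log\frac1u$ strictly plurisubharmonic, is said to give rise to a Poincaré metric if (i) the Kähler metric $g_{j\overline k}=\partial_j\overline\partial_k\log\frac1u$ is Kähler–Einstein in the sense that $\partial_j\overline\partial_k\log\det[g_{l\overline m}]=(n+1)g_{j\overline k}$ in local holomorphic coordinates, and (ii) $u$ vanishes precisely to the first order at the outer boundary, i.e. $u=0$ and $\nabla u\ne0$ on $\partial\mathbf M^n$. $C^\infty((0,1])$ denotes functions smooth on $(0,1]$,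 one-sidedly at $1$. *)

theory Defs
  imports "HOL-Complex_Analysis.Complex_Analysis"
begin

section \<open>Smooth functions\<close>

text \<open>\<open>C\<^sup>k\<close> on an open set: all iterated directional derivatives up to order \<open>k\<close> exist
  (as Frechet derivatives) and are continuous.\<close>

primrec Ck_on :: "nat \<Rightarrow> 'a::real_normed_vector set \<Rightarrow> ('a \<Rightarrow> 'b::real_normed_vector) \<Rightarrow> bool" where
  "Ck_on 0 V F \<longleftrightarrow> continuous_on V F"
| "Ck_on (Suc k) V F \<longleftrightarrow>
     (\<forall>x\<in>V. F differentiable (at x)) \<and> (\<forall>h. Ck_on k V (\<lambda>x. frechet_derivative F (at x) h))"

text \<open>Smoothness on an arbitrary subset \<open>A\<close> of a Euclidean space: local smooth extendability to the
  ambient space. For an embedded submanifold this is smoothness on the manifold; for an embedded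
  submanifold with boundary it is smoothness up to the boundary.\<close>

definition smooth_on :: "'a::euclidean_space set \<Rightarrow> ('a \<Rightarrow> real) \<Rightarrow> bool" where
  "smooth_on A u \<longleftrightarrow>
     (\<forall>p\<in>A. \<exists>V F. open V \<and> p \<in> V \<and> (\<forall>k. Ck_on k V F) \<and> (\<forall>z\<in>V \<inter> A. F z = u z))"

text \<open>\<open>C\<^sup>\<infinity>((0,1])\<close>: \<open>D k\<close> is the \<open>k\<close>-th derivative, one-sided at \<open>1\<close>.\<close>

definition smooth_Ioc01 :: "(real \<Rightarrow> real) \<Rightarrow> bool" where
  "smooth_Ioc01 f \<longleftrightarrow>
     (\<exists>D. D 0 = f \<and>
        (\<forall>k. \<forall>t\<in>{0<..1}. (D k has_real_derivative D (Suc k) t) (at t within {0<..1})))"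


section \<open>Local holomorphic coordinates\<close>

definition holomorphic_map_on ::
    "(complex ^ 'n::finite) set \<Rightarrow> (complex ^ 'n \<Rightarrow> complex ^ 'm::finite) \<Rightarrow> bool" where
  "holomorphic_map_on U \<phi> \<longleftrightarrow>
     (\<forall>w\<in>U. \<exists>D. (\<phi> has_derivative D) (at w) \<and> (\<forall>c v. D (c *s v) = c *s D v))"

text \<open>\<open>\<phi>\<close>, defined on the open set \<open>U\<close>, is the inverse of a local holomorphic coordinate system on
  the complex submanifold \<open>S\<close>.\<close>

definition local_coords ::
    "(complex ^ 'm::finite) set \<Rightarrow> (complex ^ 'n::finite) set \<Rightarrow> (complex ^ 'n \<Rightarrow> complex ^ 'm) \<Rightarrow> bool"
  where
  "local_coords S U \<phi> \<longleftrightarrow>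
     open U \<and> holomorphic_map_on U \<phi> \<and> (\<forall>w\<in>U. inj (frechet_derivative \<phi> (at w))) \<and>
     openin (top_of_set S) (\<phi> ` U) \<and> (\<exists>\<psi>. homeomorphism U (\<phi> ` U) \<phi> \<psi>)"

text \<open>The Wirtinger operators \<open>\<partial>\<^sub>j = (\<partial>/\<partial>x\<^sub>j - \<i> \<partial>/\<partial>y\<^sub>j) / 2\<close> and
  \<open>(\<partial>/\<partial>x\<^sub>j + \<i> \<partial>/\<partial>y\<^sub>j) / 2\<close>.\<close>

definition partial_along :: "complex ^ 'n::finite \<Rightarrow> (complex ^ 'n \<Rightarrow> complex) \<Rightarrow> complex ^ 'n \<Rightarrow> complex"
  where
  "partial_along e F w = vector_derivative (\<lambda>t::real. F (w + t *\<^sub>R e)) (at 0)"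

definition dz :: "'n::finite \<Rightarrow> (complex ^ 'n \<Rightarrow> complex) \<Rightarrow> complex ^ 'n \<Rightarrow> complex" where
  "dz j F w = (partial_along (axis j 1) F w - \<i> * partial_along (axis j \<i>) F w) / 2"

definition dzbar :: "'n::finite \<Rightarrow> (complex ^ 'n \<Rightarrow> complex) \<Rightarrow> complex ^ 'n \<Rightarrow> complex" where
  "dzbar j F w = (partial_along (axis j 1) F w + \<i> * partial_along (axis j \<i>) F w) / 2"

definition levi :: "(complex ^ 'n::finite \<Rightarrow> complex) \<Rightarrow> complex ^ 'n \<Rightarrow> complex ^ 'n ^ 'n" where
  "levi F w = (\<chi> j k. dz j (dzbar k F) w)"

definition pos_def_hermitian :: "complex ^ 'n ^ 'n::finite \<Rightarrow> bool" where
  "pos_def_hermitian A \<longleftrightarrow>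
     (\<forall>\<xi>. \<xi> \<noteq> 0 \<longrightarrow> (\<exists>r>0. (\<Sum>j\<in>UNIV. \<Sum>k\<in>UNIV. A $ j $ k * \<xi> $ j * cnj (\<xi> $ k)) = complex_of_real r))"


section \<open>The Kepler manifold and Poincare metrics\<close>

definition cdot :: "complex ^ 'm::finite \<Rightarrow> complex ^ 'm \<Rightarrow> complex" where
  "cdot z w = (\<Sum>j\<in>UNIV. z $ j * w $ j)"

definition kepler :: "(complex ^ 'm::finite) set" where
  "kepler = {z. cdot z z = 0 \<and> z \<noteq> 0}"

definition kepler_ball :: "(complex ^ 'm::finite) set" where
  "kepler_ball = {z \<in> kepler. norm z < 1}"

definition kepler_bdry :: "(complex ^ 'm::finite) set" where
  "kepler_bdry = {z \<in> kepler. norm z = 1}"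

text \<open>The metric \<open>g\<close> of the potential \<open>log (1/u)\<close> in the coordinates given by \<open>\<phi>\<close>.\<close>

definition metric_coeffs ::
    "(complex ^ 'm::finite \<Rightarrow> real) \<Rightarrow> (complex ^ 'n::finite \<Rightarrow> complex ^ 'm) \<Rightarrow> complex ^ 'n \<Rightarrow> complex ^ 'n ^ 'n"
  where
  "metric_coeffs u \<phi> = levi (\<lambda>w. complex_of_real (ln (1 / u (\<phi> w))))"

text \<open>The argument \<open>TYPE('n)\<close> fixes the complex dimension \<open>n = CARD('n)\<close> of the Kepler manifold in
  \<open>complex ^ 'm\<close>, to be used with \<open>CARD('m) = n + 1\<close>. In the Einstein equation \<open>ln\<close> is the principal
  logarithm, applied to the positive real number \<open>det g\<close>. In the last clause the gradient at the
  outer boundary is the one-sided one, computed from the side \<open>norm z \<le> 1\<close>, where \<open>u\<close> is given.\<close>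

definition gives_Poincare_metric ::
    "'n::finite itself \<Rightarrow> (complex ^ 'm::finite \<Rightarrow> real) \<Rightarrow> bool" where
  "gives_Poincare_metric _ u \<longleftrightarrow>
     smooth_on kepler_ball u \<and>
     (\<forall>z\<in>kepler_ball. 0 < u z) \<and>
     (\<forall>U. \<forall>\<phi> :: complex ^ 'n \<Rightarrow> complex ^ 'm. local_coords kepler_ball U \<phi> \<longrightarrow>
        (\<forall>w\<in>U. pos_def_hermitian (metric_coeffs u \<phi> w) \<and>
           (\<forall>j k. levi (\<lambda>w'. ln (det (metric_coeffs u \<phi> w'))) w $ j $ k
                    = of_nat (CARD('n) + 1) * metric_coeffs u \<phi> w $ j $ k))) \<and>
     (\<forall>z\<in>kepler_bdry. u z = 0) \<and>
     (\<forall>U. \<forall>\<phi> :: complex ^ 'n \<Rightarrow> complex ^ 'm. local_coords kepler U \<phi> \<longrightarrow>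
        (\<forall>w\<in>U. \<phi> w \<in> kepler_bdry \<longrightarrow>
           (\<exists>L. ((\<lambda>w'. u (\<phi> w')) has_derivative L)
                   (at w within {w' \<in> U. \<phi> w' \<in> kepler_ball \<union> kepler_bdry}) \<and>
                L \<noteq> (\<lambda>_. 0))))"

end

theory Submission
  imports Defs "HOL-Real_Asymp.Real_Asymp"
begin

text \<open>
  The radial ansatz \<open>u z = f ((norm z)\<^sup>2)\<close> turns the Einstein condition on the cone \<open>cdot z z = 0\<close>
  into an ordinary differential equation, and the quantity called \<open>c\<close> is a first integral of it.
  Both sides of this reduction have to be made explicit.

  The profile. With \<open>P = - t f' / f\<close> the first integral reads \<open>P\<^sup>3 + P\<^sup>2 / 2 - t / f\<^sup>3 = c\<close>, so
  that \<open>P\<close> solves an autonomous equation in \<open>ln t\<close> and blows up at \<open>t = 1\<close>. Its reciprocal \<open>V = 1 / P\<close>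
  desingularises the problem: \<open>V' = - q / t\<close> and \<open>V 1 = 0\<close> with \<open>q = 1 + V / 2 - c V\<^sup>3\<close>, a regular
  initial value problem whose solution passes smoothly through \<open>t = 1\<close>. It extends all the way
  down to \<open>t = 0\<close> because the time \<open>\<integral> dV / q\<close> needed to reach the first zero of \<open>q\<close> is infinite
  (\<open>exists_reciprocal_profile\<close>). Then \<open>f = V w\<close> with \<open>w = (t / q)\<^bsup>1/3\<^esup>\<close>, and \<open>f' = - w / t\<close>
  (\<open>exists_profile\<close>).

  The geometry. Let \<open>\<phi>\<close> parametrise a piece of the cone, with tangent vectors \<open>a\<close>, \<open>b\<close>, and let
  \<open>\<Theta> = ln (1 / f)\<close>. The metric is \<open>\<Theta>''\<close> times a rank one form plus \<open>\<Theta>'\<close> times the Gram matrix of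
  \<open>a\<close>, \<open>b\<close>. Differentiating \<open>cdot \<phi> \<phi> = 0\<close> shows that the bilinear cross product of \<open>a\<close> and \<open>b\<close> is
  a multiple \<open>\<mu> \<phi>\<close> with \<open>\<mu>\<close> holomorphic and without zeros. Vector algebra in dimension three then
  gives \<open>det g = \<bar>\<mu>\<bar>\<^sup>2 t \<Theta>' (\<Theta>' + t \<Theta>'')\<close> at \<open>t = \<bar>\<phi>\<bar>\<^sup>2\<close> (\<open>det_levi_radial\<close>), and the
  differential equation for \<open>f\<close> says exactly that this is \<open>\<bar>\<mu>\<bar>\<^sup>2 exp (3 \<Theta>)\<close>. Since \<open>ln \<bar>\<mu>\<bar>\<^sup>2\<close> is
  pluriharmonic, \<open>ln (det g)\<close> and \<open>3 \<Theta>\<close> have the same Levi form, which is the Einstein equation with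
  constant \<open>n + 1 = 3\<close> (\<open>levi_ln_det_radial\<close>).

  The coordinates \<open>\<phi>\<close> are arbitrary and known only to be complex differentiable once, so derivatives of
  \<open>\<phi>\<close> and \<open>\<mu>\<close> have to be shown holomorphic again. This is done for continuous, separately holomorphic
  functions (\<open>sep_holomorphic_on_cpartial\<close>).
\<close>


section \<open>Calculus of \<open>C\<^sup>k\<close> functions\<close>

declare Ck_on.simps(2) [simp del]

lemma Ck_on_cong:
  assumes "open V" "\<And>x. x \<in> V \<Longrightarrow> F x = G x"
  shows "Ck_on k V F \<longleftrightarrow> Ck_on k V G"
  using assms(2)
proof (induction k arbitrary: F G)
  case 0
  then show ?case by (auto intro: continuous_on_cong)
next
  case (Suc k)
  have iff: "(F has_derivative D) (at x) \<longleftrightarrow> (G has_derivative D) (at x)" if "x \<in> V" for x D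
    using has_derivative_transform_within_open[OF _ assms(1) that, of F D UNIV G]
      has_derivative_transform_within_open[OF _ assms(1) that, of G D UNIV F] Suc.prems by auto
  have "frechet_derivative F (at x) = frechet_derivative G (at x)" if "x \<in> V" for x
    unfolding frechet_derivative_def using iff[OF that] by simp
  moreover have "F differentiable (at x) \<longleftrightarrow> G differentiable (at x)" if "x \<in> V" for x
    unfolding differentiable_def using iff[OF that] by simp
  ultimately show ?case
    using Suc.IH[of "\<lambda>x. frechet_derivative F (at x) h" "\<lambda>x. frechet_derivative G (at x) h" for h]
    by (simp add: Ck_on.simps(2) cong: ball_cong)
qed

lemma Ck_on_SucI:
  assumes "open V" "\<And>x. x \<in> V \<Longrightarrow> (F has_derivative F' x) (at x)" "\<And>h. Ck_on k V (\<lambda>x. F' x h)"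
  shows "Ck_on (Suc k) V F"
proof -
  have "frechet_derivative F (at x) = F' x" if "x \<in> V" for x
    using assms(2)[OF that] frechet_derivative_at by metis
  then have "Ck_on k V (\<lambda>x. frechet_derivative F (at x) h)" for h
    using Ck_on_cong[OF assms(1), of "\<lambda>x. frechet_derivative F (at x) h" "\<lambda>x. F' x h" k] assms(3)[of h]
    by simp
  then show ?thesis using assms(2) by (auto simp: differentiable_def Ck_on.simps(2))
qed

lemma Ck_on_SucD:
  assumes "Ck_on (Suc k) V F"
  shows "\<And>x. x \<in> V \<Longrightarrow> (F has_derivative frechet_derivative F (at x)) (at x)"
    and "\<And>h. Ck_on k V (\<lambda>x. frechet_derivative F (at x) h)"
  using assms frechet_derivative_works by (auto simp: Ck_on.simps(2))

lemma Ck_on_Suc_imp: "Ck_on (Suc k) V F \<Longrightarrow> Ck_on k V F"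
proof (induction k arbitrary: F)
  case 0
  then show ?case
    by (auto simp: Ck_on.simps(2) intro!: continuous_at_imp_continuous_on differentiable_imp_continuous_within)
next
  case (Suc k)
  then show ?case by (subst (asm) Ck_on.simps(2), subst Ck_on.simps(2)) blast
qed

lemma Ck_on_const: "open V \<Longrightarrow> Ck_on k V (\<lambda>x. a)"
proof (induction k arbitrary: a)
  case (Suc k)
  then show ?case by (intro Ck_on_SucI[where F' = "\<lambda>x h. 0"]) auto
qed simp

lemma Ck_on_bounded_linear:
  assumes "bounded_linear L" "open V"
  shows "Ck_on k V L"
proof (cases k)
  case 0
  then show ?thesis using assms by (simp add: linear_continuous_on)
next
  case (Suc l)
  have "Ck_on (Suc l) V L"
    by (rule Ck_on_SucI[where F' = "\<lambda>x. L"])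
      (use assms in \<open>auto intro: bounded_linear_imp_has_derivative Ck_on_const\<close>)
  then show ?thesis using Suc by simp
qed

lemma Ck_on_add:
  assumes "open V"
  shows "Ck_on k V F \<Longrightarrow> Ck_on k V G \<Longrightarrow> Ck_on k V (\<lambda>x. F x + G x)"
proof (induction k arbitrary: F G)
  case (Suc k)
  define F' where "F' x = frechet_derivative F (at x)" for x
  note F' = Ck_on_SucD[OF Suc.prems(1), folded F'_def]
  define G' where "G' x = frechet_derivative G (at x)" for x
  note G' = Ck_on_SucD[OF Suc.prems(2), folded G'_def]
  show ?case
    by (rule Ck_on_SucI[where F' = "\<lambda>x h. F' x h + G' x h"])
      (use F' G' Suc.IH assms in \<open>auto intro!: has_derivative_add\<close>)
qed (auto intro: continuous_intros)

lemma Ck_on_mult: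
  fixes F G :: "'a::real_normed_vector \<Rightarrow> real"
  assumes "open V"
  shows "Ck_on k V F \<Longrightarrow> Ck_on k V G \<Longrightarrow> Ck_on k V (\<lambda>x. F x * G x)"
proof (induction k arbitrary: F G)
  case (Suc k)
  define F' where "F' x = frechet_derivative F (at x)" for x
  note F' = Ck_on_SucD[OF Suc.prems(1), folded F'_def]
  define G' where "G' x = frechet_derivative G (at x)" for x
  note G' = Ck_on_SucD[OF Suc.prems(2), folded G'_def]
  show ?case
    by (rule Ck_on_SucI[where F' = "\<lambda>x h. F x * G' x h + F' x h * G x"])
      (use F' G' in \<open>auto intro!: has_derivative_mult Ck_on_add Suc.IH Ck_on_Suc_imp[OF Suc.prems(1)] Ck_on_Suc_imp[OF Suc.prems(2)] assms\<close>)
qed (auto intro: continuous_intros)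

text \<open>Only the derivative of the outer function is composed with the inner one, so the induction must
  leave the outer function free while the inner one stays fixed.\<close>

lemma Ck_on_compose:
  fixes F :: "'a::real_normed_vector \<Rightarrow> real" and g :: "real \<Rightarrow> real"
  assumes "open V" "F ` V \<subseteq> I"
  shows "Ck_on k I g \<Longrightarrow> Ck_on k V F \<Longrightarrow> Ck_on k V (\<lambda>x. g (F x))"
proof (induction k arbitrary: g)
  case 0
  then show ?case using assms(2) by (auto intro: continuous_on_compose2)
next
  case (Suc k)
  define g' where "g' x = frechet_derivative g (at x)" for x
  note g' = Ck_on_SucD[OF Suc.prems(1), folded g'_def]
  define F' where "F' x = frechet_derivative F (at x)" for x
  note F' = Ck_on_SucD[OF Suc.prems(2), folded F'_def]
  have "((\<lambda>x. g (F x)) has_derivative (\<lambda>h. g' (F x) 1 * F' x h)) (at x)" if "x \<in> V" for x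
  proof -
    have gF: "(g has_derivative g' (F x)) (at (F x))"
      using g'(1) that assms(2) by auto
    then have "linear (g' (F x))" by (rule has_derivative_linear)
    have "g' (F x) y = g' (F x) 1 * y" for y
      using linear_cmul[OF \<open>linear (g' (F x))\<close>, of y 1] by (simp add: mult.commute)
    then have eq: "(\<lambda>h. g' (F x) (F' x h)) = (\<lambda>h. g' (F x) 1 * F' x h)"
      by (intro ext)
    show ?thesis
      using has_derivative_compose[OF F'(1)[OF that] gF] unfolding eq .
  qed
  moreover have "Ck_on k V (\<lambda>x. g' (F x) 1 * F' x h)" for h
    by (rule Ck_on_mult[OF assms(1) Suc.IH[OF g'(2) Ck_on_Suc_imp[OF Suc.prems(2)]] F'(2)])
  ultimately show ?case
    by (rule Ck_on_SucI[OF assms(1)])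
qed

text \<open>The bootstrapping step: solutions of a differential equation with smooth right-hand side gain
  one order of differentiability at a time.\<close>

lemma Ck_on_Suc_real:
  fixes F :: "real \<Rightarrow> real"
  assumes "open V" "\<And>x. x \<in> V \<Longrightarrow> (F has_real_derivative F' x) (at x)" "Ck_on k V F'"
  shows "Ck_on (Suc k) V F"
proof (rule Ck_on_SucI[OF assms(1)])
  show "(F has_derivative (\<lambda>h. F' x * h)) (at x)" if "x \<in> V" for x
    using assms(2)[OF that] by (simp add: has_field_derivative_def)
  show "Ck_on k V (\<lambda>x. F' x * h)" for h
    by (intro Ck_on_mult Ck_on_const assms)
qed

lemma Ck_on_deriv:
  fixes F :: "real \<Rightarrow> real"
  assumes "open V" "Ck_on (Suc k) V F"
  shows "Ck_on k V (deriv F)" "\<And>x. x \<in> V \<Longrightarrow> (F has_real_derivative deriv F x) (at x)"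
proof -
  define F' where "F' x = frechet_derivative F (at x)" for x
  note F' = Ck_on_SucD[OF assms(2), folded F'_def]
  have D: "(F has_real_derivative F' x 1) (at x)" if "x \<in> V" for x
  proof -
    have "linear (F' x)" using F'(1)[OF that] by (rule has_derivative_linear)
    have eq: "F' x = (*) (F' x 1)"
    proof
      show "F' x y = F' x 1 * y" for y
        using linear_cmul[OF \<open>linear (F' x)\<close>, of y 1] by (simp add: mult.commute)
    qed
    show ?thesis unfolding has_field_derivative_def eq[symmetric] by (rule F'(1)[OF that])
  qed
  then have "deriv F x = F' x 1" if "x \<in> V" for x
    using that by (simp add: DERIV_imp_deriv)
  then show "Ck_on k V (deriv F)" "\<And>x. x \<in> V \<Longrightarrow> (F has_real_derivative deriv F x) (at x)"
    using Ck_on_cong[OF assms(1), of "deriv F" "\<lambda>x. F' x 1" k] F'(2) D by auto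
qed

lemma smooth_Ioc01I:
  assumes "open I" "{0<..1} \<subseteq> I" "\<And>k. Ck_on k I f"
  shows "smooth_Ioc01 f"
proof -
  have Ck: "Ck_on l I ((deriv ^^ k) f)" for k l
  proof (induction k arbitrary: l)
    case (Suc k)
    show ?case using Ck_on_deriv(1)[OF assms(1) Suc[of "Suc l"]] by (simp only: funpow.simps o_apply)
  qed (simp add: assms(3))
  have "((deriv ^^ k) f has_real_derivative (deriv ^^ Suc k) f t) (at t within {0<..1})"
    if "t \<in> {0<..1}" for k t
  proof -
    have "t \<in> I" using that assms(2) by blast
    show ?thesis
      using has_field_derivative_at_within[OF Ck_on_deriv(2)[OF assms(1) Ck[of "Suc 0" k] \<open>t \<in> I\<close>], of "{0<..1}"]
      unfolding funpow.simps(2) o_apply .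
  qed
  then show ?thesis unfolding smooth_Ioc01_def
    by (intro exI[of _ "\<lambda>k. (deriv ^^ k) f"]) auto
qed

text \<open>The squared norm, unlike the norm, is a polynomial; a profile that is smooth beyond the end of the
  interval of interest therefore gives smoothness up to the boundary.\<close>

lemma smooth_on_norm_sq:
  fixes A :: "'a::euclidean_space set"
  assumes "open I" "\<And>k. Ck_on k I f" "\<And>z. z \<in> A \<Longrightarrow> (norm z)\<^sup>2 \<in> I"
  shows "smooth_on A (\<lambda>z. f ((norm z)\<^sup>2))"
proof -
  define V where "V = (\<lambda>z::'a. (norm z)\<^sup>2) -` I"
  have V: "open V" unfolding V_def using assms(1)
    by (intro open_vimage) (auto intro!: continuous_intros)
  have *: "Ck_on (Suc k) V (\<lambda>z. (norm z)\<^sup>2)" for k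
  proof (rule Ck_on_SucI[OF V])
    show "((\<lambda>z. (norm z)\<^sup>2) has_derivative (\<lambda>h. 2 * (x \<bullet> h))) (at x)" for x :: 'a
      unfolding power2_norm_eq_inner
      by (auto intro!: derivative_eq_intros simp: inner_commute)
    show "Ck_on k V (\<lambda>x. 2 * (x \<bullet> h))" for h
      by (intro Ck_on_mult Ck_on_const V Ck_on_bounded_linear bounded_linear_inner_left)
  qed
  then have "Ck_on k V (\<lambda>z. f ((norm z)\<^sup>2))" for k
    by (intro Ck_on_compose[OF V _ assms(2)] Ck_on_Suc_imp[OF *]) (auto simp: V_def)
  then show ?thesis
    unfolding smooth_on_def using V assms(3)
    by (intro ballI exI[of _ V] exI[of _ "\<lambda>z. f ((norm z)\<^sup>2)"]) (auto simp: V_def)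
qed


section \<open>The differential equation for the reciprocal profile\<close>

text \<open>Separation of variables: the solution of \<open>g' y = q (g y)\<close> is the inverse of an antiderivative \<open>S\<close> of
  \<open>1 / q\<close>. The linear upper bound on \<open>q\<close> at the end point \<open>b\<close> makes \<open>S\<close> diverge there at least
  logarithmically, which is why the solution lives for all positive times.\<close>

lemma inverse_ode_solution:
  fixes q :: "real \<Rightarrow> real"
  assumes q: "continuous_on {a..<b} q" "\<And>x. x \<in> {a..<b} \<Longrightarrow> 0 < q x" and ab: "a < 0" "0 < b"
    and K: "0 < K" "\<And>x. x \<in> {0..<b} \<Longrightarrow> q x \<le> K * (b - x)"
  shows "\<exists>m<0. \<exists>g. g 0 = 0 \<and>
    (\<forall>y>m. g y \<in> {a<..<b} \<and> (g has_real_derivative q (g y)) (at y) \<and> (0 < y \<longrightarrow> 0 < g y))"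
proof -
  define S where "S x = integral {a..x} (\<lambda>x. 1 / q x) - integral {a..0} (\<lambda>x. 1 / q x)" for x
  have S0: "S 0 = 0" by (simp add: S_def)
  have DS: "(S has_real_derivative 1 / q x) (at x)" if x: "a < x" "x < b" for x
  proof -
    define b' where "b' = (x + b) / 2"
    have b': "x < b'" "b' < b" using x by (auto simp: b'_def)
    have "continuous_on {a..b'} (\<lambda>x. 1 / q x)"
      using b' q(2) by (intro continuous_intros continuous_on_subset[OF q(1)]) fastforce+
    then have "((\<lambda>x. integral {a..x} (\<lambda>x. 1 / q x)) has_real_derivative 1 / q x) (at x within {a..b'})"
      using x b' by (intro integral_has_real_derivative) auto
    moreover have "at x within {a..b'} = at x"
      using x b' by (intro at_within_interior) auto
    ultimately have "((\<lambda>x. integral {a..x} (\<lambda>x. 1 / q x)) has_real_derivative 1 / q x) (at x)"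
      by simp
    from DERIV_diff[OF this DERIV_const[of "integral {a..0} (\<lambda>x. 1 / q x)"]]
    show ?thesis unfolding S_def by simp
  qed
  have mono: "S x < S y" if "a < x" "x < y" "y < b" for x y
  proof (rule DERIV_pos_imp_increasing[OF that(2)])
    fix z assume "x \<le> z" "z \<le> y"
    with that have z: "a < z" "z < b" by auto
    then have "0 < 1 / q z" using q(2)[of z] by simp
    with DS[OF z] show "\<exists>D. (S has_real_derivative D) (at z) \<and> 0 < D" by blast
  qed
  have large: "S x \<ge> (ln b - ln (b - x)) / K" if x: "0 \<le> x" "x < b" for x
  proof -
    have "S 0 + ln (b - 0) / K \<le> S x + ln (b - x) / K"
    proof (rule DERIV_nonneg_imp_nondecreasing[OF x(1)])
      fix y assume y: "0 \<le> y" "y \<le> x"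
      have yb: "a < y" "y < b" using y x ab by auto
      have "((\<lambda>x. ln (b - x)) has_real_derivative - (1 / (b - y))) (at y)"
        using yb by (auto intro!: derivative_eq_intros)
      from DERIV_cdivide[OF this, of K]
      have "((\<lambda>x. ln (b - x) / K) has_real_derivative - (1 / (K * (b - y)))) (at y)"
        by (simp add: mult.commute)
      then have "((\<lambda>x. S x + ln (b - x) / K) has_real_derivative 1 / q y + - (1 / (K * (b - y)))) (at y)"
        by (rule DERIV_add[OF DS[OF yb]])
      moreover have "1 / (K * (b - y)) \<le> 1 / q y"
        using K(2)[of y] q(2)[of y] y x ab by (intro divide_left_mono) (auto intro!: mult_pos_pos K(1))
      ultimately show "\<exists>z. ((\<lambda>x. S x + ln (b - x) / K) has_real_derivative z) (at y) \<and> 0 \<le> z"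
        by (intro exI[of _ "1 / q y + - (1 / (K * (b - y)))"]) simp
    qed
    then show ?thesis using S0 by (simp add: diff_divide_distrib)
  qed
  \<comment> \<open>stay away from \<open>a\<close>, where the antiderivative need not be differentiable\<close>
  define a' where "a' = a / 2"
  have a': "a < a'" "a' < 0" using ab by (auto simp: a'_def)
  define m where "m = S a'"
  have m: "m < 0" using mono[of a' 0] a' ab S0 by (simp add: m_def)
  have surj: "\<exists>x. a' < x \<and> x < b \<and> S x = y" if y: "m < y" for y
  proof -
    \<comment> \<open>chosen so that the logarithmic lower bound for \<open>S x1\<close> equals \<open>max y 0 + 1\<close>\<close>
    define x1 where "x1 = b - b * exp (- (K * (max y 0 + 1)))"
    have "0 < K * (max y 0 + 1)" using K(1) by (intro mult_pos_pos) auto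
    then have e: "exp (- (K * (max y 0 + 1))) < 1" by simp
    have x1: "0 \<le> x1" "x1 < b" using e ab by (auto simp: x1_def)
    have "b - x1 = b * exp (- (K * (max y 0 + 1)))" by (simp add: x1_def)
    then have "ln (b - x1) = ln b - K * (max y 0 + 1)" using ab by (simp add: ln_mult)
    then have "(ln b - ln (b - x1)) / K = max y 0 + 1" using K(1) by simp
    then have "y \<le> S x1" using large[OF x1] by linarith
    then obtain x where x: "a' \<le> x" "x \<le> x1" "S x = y"
      using IVT[of S a' y x1] y x1 a' DERIV_isCont[OF DS] by (auto simp: m_def)
    moreover have "x \<noteq> a'" using x(3) y by (auto simp: m_def)
    ultimately show ?thesis using x1 by (intro exI[of _ x]) auto
  qed
  define g where "g y = (SOME x. a' < x \<and> x < b \<and> S x = y)" for y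
  have g: "a' < g y" "g y < b" "S (g y) = y" if "m < y" for y
    using someI_ex[OF surj[OF that]] unfolding g_def by auto
  have gS: "g (S x) = x" if "a' < x" "x < b" for x
  proof -
    have "m < S x" using mono[of a' x] that a' by (simp add: m_def)
    from g[OF this] show ?thesis
      using mono[of x "g (S x)"] mono[of "g (S x)" x] that a' by linarith
  qed
  have isC: "isCont g y" if "m < y" for y
  proof -
    define l where "l = (a' + g y) / 2"
    define r where "r = (b + g y) / 2"
    have lr: "a' < l" "l < g y" "g y < r" "r < b" using g[OF that] by (auto simp: l_def r_def)
    have "isCont g (S (g y))"
    proof (rule isCont_inverse_function2[OF lr(2,3)])
      fix z assume "l \<le> z" "z \<le> r"
      with lr a' have z: "a' < z" "z < b" "a < z" by auto
      show "g (S z) = z" by (rule gS[OF z(1,2)])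
      show "isCont S z" by (rule DERIV_isCont[OF DS[OF z(3,2)]])
    qed
    then show ?thesis using g(3)[OF that] by simp
  qed
  show ?thesis
  proof (intro exI[of _ m] exI[of _ g] conjI allI impI m)
    show "g 0 = 0" using gS[of 0] S0 a' ab by simp
    fix y assume y: "m < y"
    show "g y \<in> {a<..<b}" using g[OF y] a' by auto
    have "DERIV g y :> inverse (1 / q (g y))"
    proof (rule DERIV_inverse_function[where a = m and b = "y + 1" and f = S])
      show "DERIV S (g y) :> 1 / q (g y)" using DS g[OF y] a' by simp
      show "1 / q (g y) \<noteq> 0" using q(2)[of "g y"] g[OF y] a' by simp
    qed (use y g(3) isC in auto)
    then show "(g has_real_derivative q (g y)) (at y)" by simp
    assume "0 < y"
    show "0 < g y"
    proof (rule ccontr)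
      assume "\<not> 0 < g y"
      then have "S (g y) \<le> S 0"
        using mono[of "g y" 0] g[OF y] a' ab by (cases "g y = 0") auto
      then show False using g(3)[OF y] S0 \<open>0 < y\<close> by simp
    qed
  qed
qed

text \<open>In the variable \<open>- ln t\<close> this is the autonomous equation \<open>g' = 1 + g / 2 - c g\<^sup>3\<close>. For \<open>c > 0\<close>
  the solution increases towards the positive zero of the cubic; for \<open>c = 0\<close> there is no such zero,
  but the equation is linear and is solved explicitly.\<close>

lemma exists_reciprocal_profile:
  fixes c :: real
  assumes "0 \<le> c"
  shows "\<exists>T>1. \<exists>V. V 1 = 0 \<and> (\<forall>t\<in>{0<..<T}. 0 < 1 + V t / 2 - c * V t ^ 3 \<and>
    (V has_real_derivative - (1 + V t / 2 - c * V t ^ 3) / t) (at t) \<and> (t < 1 \<longrightarrow> 0 < V t))"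
proof (cases "c = 0")
  case True
  have D: "((\<lambda>t. 2 * (1 / sqrt t - 1)) has_real_derivative - (1 / sqrt t) / t) (at t)" if "0 < t" for t :: real
  proof -
    have "((\<lambda>t. 2 * (1 / sqrt t - 1)) has_real_derivative
        2 * (0 * sqrt t - 1 * (inverse (sqrt t) / 2)) / (sqrt t * sqrt t)) (at t)"
      using DERIV_cmult[OF DERIV_diff[OF DERIV_divide[OF DERIV_const[of 1] DERIV_real_sqrt[OF that]] DERIV_const[of 1]], of 2]
        that by simp
    moreover have "2 * (0 * sqrt t - 1 * (inverse (sqrt t) / 2)) / (sqrt t * sqrt t) = - (1 / sqrt t) / t"
      using that by (simp add: inverse_eq_divide)
    ultimately show ?thesis by (simp only:)
  qed
  moreover have "0 < 2 * (1 / sqrt t - 1)" if "0 < t" "t < 1" for t :: real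
  proof -
    have "0 < sqrt t" "sqrt t < 1" using that by auto
    then show ?thesis by (simp add: less_divide_eq)
  qed
  moreover have "1 + 2 * (1 / sqrt t - 1) / 2 = 1 / sqrt t" for t :: real
    by (simp add: diff_divide_distrib)
  ultimately show ?thesis using True D
    by (intro exI[of _ 2] conjI exI[of _ "\<lambda>t. 2 * (1 / sqrt t - 1)"] ballI impI) (simp_all del: right_diff_distrib_numeral)
next
  case False
  with assms have c: "0 < c" by simp
  define q where "q x = 1 + x / 2 - c * x ^ 3" for x
  have cont: "continuous_on A q" for A unfolding q_def by (intro continuous_intros) auto
  \<comment> \<open>any point at which the cubic term dominates\<close>
  define M where "M = 1 + 2 / c"
  have "q M \<le> 0"
  proof -
    have M: "1 \<le> M" using c by (simp add: M_def)
    have "1 + M / 2 \<le> 2 * M" using M by simp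
    also have "\<dots> \<le> (c * M) * M" using c by (intro mult_right_mono) (auto simp: M_def field_simps)
    also have "\<dots> \<le> (c * M) * (M * M)" using M c by (intro mult_left_mono) auto
    finally show ?thesis by (simp add: q_def power3_eq_cube mult_ac)
  qed
  then obtain b where b: "0 \<le> b" "q b = 0"
    using IVT2'[of q M 0 0] cont c by (auto simp: q_def M_def)
  have "b \<noteq> 0" using b(2) by (auto simp: q_def)
  with b have b0: "0 < b" by simp
  have cb: "c * b ^ 3 = 1 + b / 2" using b(2) by (simp add: q_def)
  \<comment> \<open>dividing out the root gives the linear bound that makes the time to reach it infinite\<close>
  have fac: "q x = (b - x) * (c * (b\<^sup>2 + b * x + x\<^sup>2) - 1 / 2)" for x
  proof -
    have "q x - q b = (b - x) * (c * (b\<^sup>2 + b * x + x\<^sup>2) - 1 / 2)"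
      by (simp add: q_def power2_eq_square power3_eq_cube field_simps)
    then show ?thesis using b(2) by simp
  qed
  have cb2: "c * b\<^sup>2 = 1 / b + 1 / 2" using cb b0 by (simp add: divide_simps power2_eq_square power3_eq_cube)
  have pos: "0 < q x" if "x \<in> {-1..<b}" for x
  proof (cases "0 \<le> x")
    case True
    have "0 \<le> c * (b * x + x\<^sup>2)" using True c b0 by auto
    moreover have "c * (b\<^sup>2 + b * x + x\<^sup>2) = c * b\<^sup>2 + c * (b * x + x\<^sup>2)"
      by (simp add: algebra_simps)
    moreover have "0 < 1 / b" using b0 by simp
    ultimately have "1 / 2 < c * (b\<^sup>2 + b * x + x\<^sup>2)"
      using cb2 by linarith
    then show ?thesis unfolding fac using that by (intro mult_pos_pos) auto
  next
    case False
    then have "x ^ 3 \<le> 0" by simp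
    then have "c * x ^ 3 \<le> 0" using c by (simp add: mult_nonneg_nonpos)
    then show ?thesis using that unfolding q_def by auto
  qed
  have K: "q x \<le> (3 * c * b\<^sup>2) * (b - x)" if "x \<in> {0..<b}" for x
  proof -
    have "b * x \<le> b\<^sup>2" "x\<^sup>2 \<le> b\<^sup>2" using that b0
      by (auto simp: power2_eq_square intro!: mult_mono)
    then have "c * (b\<^sup>2 + b * x + x\<^sup>2) \<le> c * (3 * b\<^sup>2)" using c by (intro mult_left_mono) auto
    then have "c * (b\<^sup>2 + b * x + x\<^sup>2) - 1 / 2 \<le> 3 * c * b\<^sup>2" by simp
    then have "(c * (b\<^sup>2 + b * x + x\<^sup>2) - 1 / 2) * (b - x) \<le> (3 * c * b\<^sup>2) * (b - x)"
      using that by (intro mult_right_mono) auto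
    then show ?thesis unfolding fac by (simp add: mult.commute)
  qed
  obtain m g where m: "m < 0" and g0: "g 0 = 0" and g: "\<And>y. m < y \<Longrightarrow> g y \<in> {-1<..<b}"
      "\<And>y. m < y \<Longrightarrow> (g has_real_derivative q (g y)) (at y)" "\<And>y. m < y \<Longrightarrow> 0 < y \<Longrightarrow> 0 < g y"
    using inverse_ode_solution[of "-1" b q "3 * c * b\<^sup>2"] cont pos b0 c K by auto
  have mm: "m < - ln t" if "0 < t" "t < exp (- m)" for t
  proof -
    have "ln t < ln (exp (- m))" using that by (subst ln_less_cancel_iff) auto
    then show ?thesis by simp
  qed
  have D: "((\<lambda>t. g (- ln t)) has_real_derivative - q (g (- ln t)) / t) (at t)"
    if "0 < t" "t < exp (- m)" for t
  proof -
    have "((\<lambda>t. - ln t) has_real_derivative - (1 / t)) (at t)"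
      using that by (auto intro!: derivative_eq_intros)
    from DERIV_chain2[OF g(2)[OF mm[OF that]] this] show ?thesis by simp
  qed
  show ?thesis
  proof (intro exI[of _ "exp (- m)"] exI[of _ "\<lambda>t. g (- ln t)"] conjI ballI impI)
    show "1 < exp (- m)" using m by simp
    show "g (- ln 1) = 0" using g0 by simp
    fix t assume t: "t \<in> {0<..<exp (- m)}"
    then have mt: "m < - ln t" using mm by simp
    show "0 < 1 + g (- ln t) / 2 - c * g (- ln t) ^ 3"
      using pos[of "g (- ln t)"] g(1)[OF mt] by (simp add: q_def)
    show "((\<lambda>t. g (- ln t)) has_real_derivative - (1 + g (- ln t) / 2 - c * g (- ln t) ^ 3) / t) (at t)"
      using D[of t] t by (simp add: q_def)
    show "0 < g (- ln t)" if "t < 1" using g(3)[OF mt] that t by simp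
  qed
qed


section \<open>The radial profile\<close>

lemma Ck_on_real_0:
  fixes F :: "real \<Rightarrow> real"
  assumes "\<And>x. x \<in> V \<Longrightarrow> (F has_real_derivative F' x) (at x)"
  shows "Ck_on 0 V F"
  using assms by (auto intro!: continuous_at_imp_continuous_on dest: DERIV_isCont)

lemma Ck_on_inverse_Ioo:
  "0 \<le> a \<Longrightarrow> Ck_on k {a<..<b::real} (\<lambda>t. 1 / t)"
proof (induction k)
  case 0
  then show ?case by (auto intro!: continuous_intros)
next
  case (Suc k)
  have "((\<lambda>t. 1 / t) has_real_derivative (- 1) * ((1 / t) * (1 / t))) (at t)" if "t \<in> {a<..<b}" for t
    using that Suc.prems by (auto intro!: derivative_eq_intros)
  moreover have "Ck_on k {a<..<b} (\<lambda>t. (- 1) * ((1 / t) * (1 / t)))"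
    by (intro Ck_on_mult Ck_on_const open_greaterThanLessThan Suc)
  ultimately show ?case
    by (rule Ck_on_Suc_real[OF open_greaterThanLessThan])
qed

text \<open>The product \<open>f = V w\<close> is chosen so that \<open>w\<^sup>3 q = t\<close>, which makes \<open>t f' = - w\<close> free of the
  singularity that \<open>f' / f\<close> has at \<open>t = 1\<close>. The pair \<open>(V, w)\<close> solves a first order system
  with smooth right-hand side, hence is smooth across \<open>t = 1\<close>.\<close>

lemma exists_profile:
  fixes c :: real
  assumes "0 \<le> c"
  obtains T f f' f'' where "1 < T" "\<And>k. Ck_on k {0<..<T} f" "f 1 = 0" "f' 1 = -1"
    "\<And>t. t \<in> {0<..<T} \<Longrightarrow> (f has_real_derivative f' t) (at t)"
    "\<And>t. t \<in> {0<..<T} \<Longrightarrow> (f' has_real_derivative f'' t) (at t)"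
    "\<And>t. t \<in> {0<..<T} \<Longrightarrow> f' t < 0"
    "\<And>t. t \<in> {0<..<1} \<Longrightarrow> 0 < f t"
    "\<And>t. t \<in> {0<..<1} \<Longrightarrow> t * f' t * (f t * f' t + t * f t * f'' t - t * (f' t)\<^sup>2) = 1"
    "\<And>t. t \<in> {0<..<1} \<Longrightarrow> - (t / f t ^ 3) + t\<^sup>2 * (f' t)\<^sup>2 / (2 * (f t)\<^sup>2) - t ^ 3 * f' t ^ 3 / f t ^ 3 = c"
proof -
  obtain T V where T: "1 < T" and V1: "V 1 = 0" and V: "\<forall>t\<in>{0<..<T}. 0 < 1 + V t / 2 - c * V t ^ 3 \<and>
    (V has_real_derivative - (1 + V t / 2 - c * V t ^ 3) / t) (at t) \<and> (t < 1 \<longrightarrow> 0 < V t)"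
    using exists_reciprocal_profile[OF assms] by metis
  define I where "I = {0<..<T}"
  have I: "open I" by (simp add: I_def)
  define q where "q t = 1 + V t / 2 - c * V t ^ 3" for t
  \<comment> \<open>the cube root of \<open>t / q t\<close>\<close>
  define w where "w t = exp ((ln t - ln (q t)) / 3)" for t
  have qpos: "0 < q t" and DV: "(V has_real_derivative - q t * (1 / t)) (at t)"
    and Vpos: "t < 1 \<Longrightarrow> 0 < V t" and tpos: "0 < t" if "t \<in> I" for t
    using V that by (auto simp: I_def q_def)
  have wpos: "0 < w t" for t by (simp add: w_def)
  have w3: "w t ^ 3 = t / q t" if "t \<in> I" for t
  proof -
    have "w t ^ 3 = exp (ln t - ln (q t))" by (simp add: w_def flip: exp_of_nat_mult)
    also have "\<dots> = t / q t" using tpos[OF that] qpos[OF that] by (simp add: exp_diff)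
    finally show ?thesis .
  qed
  have Dq: "(q has_real_derivative (1 / 2 - 3 * c * V t ^ 2) * (- q t * (1 / t))) (at t)" if "t \<in> I" for t
  proof -
    define d where "d = - q t * (1 / t)"
    have D: "(V has_real_derivative d) (at t)" using DV[OF that] by (simp only: d_def)
    have "(q has_real_derivative (0 + d / 2) - c * (of_nat 3 * (d * V t ^ (3 - Suc 0)))) (at t)"
      unfolding q_def
      by (intro DERIV_diff DERIV_add DERIV_const DERIV_cdivide DERIV_cmult DERIV_power D)
    moreover have "(0 + d / 2) - c * (of_nat 3 * (d * V t ^ (3 - Suc 0))) = (1 / 2 - 3 * c * V t ^ 2) * d"
      by (simp add: algebra_simps)
    ultimately show ?thesis unfolding d_def[symmetric] by (simp only:)
  qed
  have Dw: "(w has_real_derivative w t * (1 / t) * (1 / 2 - c * V t ^ 2)) (at t)" if t: "t \<in> I" for t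
  proof -
    have "((\<lambda>t. ln (q t)) has_real_derivative 1 / q t * ((1 / 2 - 3 * c * V t ^ 2) * (- q t * (1 / t)))) (at t)"
      by (rule DERIV_chain2[OF DERIV_ln_divide[OF qpos[OF t]] Dq[OF t]])
    moreover have "1 / q t * ((1 / 2 - 3 * c * V t ^ 2) * (- q t * (1 / t))) = - (1 / t) * (1 / 2 - 3 * c * V t ^ 2)"
      using qpos[OF t] by simp
    ultimately have lq: "((\<lambda>t. ln (q t)) has_real_derivative - (1 / t) * (1 / 2 - 3 * c * V t ^ 2)) (at t)"
      by (simp only:)
    have "((\<lambda>t. (ln t - ln (q t)) / 3) has_real_derivative (1 / t - - (1 / t) * (1 / 2 - 3 * c * V t ^ 2)) / 3) (at t)"
      by (rule DERIV_cdivide[OF DERIV_diff[OF DERIV_ln_divide[OF tpos[OF t]] lq]])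
    from DERIV_chain2[OF DERIV_exp this]
    have "(w has_real_derivative w t * ((1 / t - - (1 / t) * (1 / 2 - 3 * c * V t ^ 2)) / 3)) (at t)"
      unfolding w_def .
    moreover have "(1 / t - - (1 / t) * (1 / 2 - 3 * c * V t ^ 2)) / 3 = (1 / t) * (1 / 2 - c * V t ^ 2)"
    proof -
      have "(x - - x * (1 / 2 - 3 * c * y)) / 3 = x * (1 / 2 - c * y)" for x y :: real
        by (simp add: field_simps)
      then show ?thesis .
    qed
    ultimately show ?thesis by (simp only: mult.assoc)
  qed
  have Ck: "Ck_on k I V \<and> Ck_on k I w" for k
  proof (induction k)
    case 0
    show ?case using Ck_on_real_0[OF DV] Ck_on_real_0[OF Dw] by auto
  next
    case (Suc k)
    then have V: "Ck_on k I V" and w: "Ck_on k I w" by auto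
    have inv: "Ck_on k I (\<lambda>t. 1 / t)" unfolding I_def by (rule Ck_on_inverse_Ioo) simp
    note intros = Ck_on_mult[OF I] Ck_on_add[OF I] Ck_on_const[OF I] V w inv
    have q: "Ck_on k I (\<lambda>t. (- 1) * (1 + V t * (1 / 2) + ((- c) * V t) * (V t * V t)))"
      by (intro intros)
    have eq: "(\<lambda>t. (- 1) * (1 + V t * (1 / 2) + ((- c) * V t) * (V t * V t))) = (\<lambda>t. - q t)"
      by (simp add: q_def power3_eq_cube fun_eq_iff)
    have "Ck_on (Suc k) I V"
      by (rule Ck_on_Suc_real[OF I DV Ck_on_mult[OF I q[unfolded eq] inv]])
    moreover have "Ck_on k I (\<lambda>t. w t * (1 / t) * (1 / 2 + ((- c) * V t) * V t))"
      by (intro intros)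
    moreover have "(\<lambda>t. w t * (1 / t) * (1 / 2 + ((- c) * V t) * V t)) = (\<lambda>t. w t * (1 / t) * (1 / 2 - c * V t ^ 2))"
      by (simp add: power2_eq_square fun_eq_iff)
    ultimately show ?case
      using Ck_on_Suc_real[OF I Dw, where k = k] by simp
  qed
  define f where "f t = V t * w t" for t
  define f' where "f' t = - w t * (1 / t)" for t
  define f'' where "f'' t = w t * (1 / t) * (1 / t) * (1 / 2 + c * V t ^ 2)" for t
  show thesis
  proof (rule that[of T f f' f''])
    show "Ck_on k {0<..<T} f" for k
      using Ck_on_mult[OF I, of k V w] Ck[of k] unfolding f_def I_def by auto
    show "f 1 = 0" by (simp add: f_def V1)
    show "f' 1 = -1" by (simp add: f'_def w_def q_def V1)
    fix t :: real
    {
      assume "t \<in> {0<..<T}"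
      then have t: "t \<in> I" by (simp add: I_def)
      note t0 = tpos[OF t]
      show "f' t < 0" using wpos t0 by (simp add: f'_def)
      have "(f has_real_derivative (- q t * (1 / t)) * w t + (w t * (1 / t) * (1 / 2 - c * V t ^ 2)) * V t) (at t)"
        unfolding f_def using DERIV_mult[OF DV[OF t] Dw[OF t]] by (simp only: mult.commute)
      moreover have "(- q t * (1 / t)) * w t + (w t * (1 / t) * (1 / 2 - c * V t ^ 2)) * V t = f' t"
        by (simp add: f'_def q_def power2_eq_square power3_eq_cube algebra_simps)
      ultimately show "(f has_real_derivative f' t) (at t)" by simp
      have inv: "((\<lambda>t. 1 / t) has_real_derivative - ((1 / t) * (1 / t))) (at t)"
        using t0 by (auto intro!: derivative_eq_intros)
      have "(f' has_real_derivative (- (w t * (1 / t) * (1 / 2 - c * V t ^ 2))) * (1 / t) + - ((1 / t) * (1 / t)) * (- w t)) (at t)"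
        unfolding f'_def using DERIV_mult[OF DERIV_minus[OF Dw[OF t]] inv] by simp
      moreover have "(- (w t * (1 / t) * (1 / 2 - c * V t ^ 2))) * (1 / t) + - ((1 / t) * (1 / t)) * (- w t) = f'' t"
        by (simp add: f''_def algebra_simps)
      ultimately show "(f' has_real_derivative f'' t) (at t)" by simp
    }
    assume t01: "t \<in> {0<..<1}"
    then have t: "t \<in> I" using T by (simp add: I_def)
    note t0 = tpos[OF t]
    have v: "0 < V t" using Vpos[OF t] t01 by simp
    show "0 < f t" using v wpos by (simp add: f_def)
    have qt: "w t ^ 3 * q t = t" using w3[OF t] qpos[OF t] by simp
    have "t * f' t * (f t * f' t + t * f t * f'' t - t * (f' t)\<^sup>2) = (w t ^ 3 * q t) / t"
    proof -
      have d: "t * f' t = - w t" "t * f'' t = w t * (1 / t) * (1 / 2 + c * V t ^ 2)"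
        using t0 by (auto simp: f'_def f''_def)
      have "t * f' t * (f t * f' t + t * f t * f'' t - t * (f' t)\<^sup>2)
        = (t * f' t) * (f t * f' t + f t * (t * f'' t) - (t * f' t) * f' t)"
        by (simp add: power2_eq_square algebra_simps)
      also have "\<dots> = - w t * (f t * f' t + f t * (w t * (1 / t) * (1 / 2 + c * V t ^ 2)) - (- w t) * f' t)"
        by (simp only: d)
      also have "\<dots> = (w t ^ 3 * q t) * (1 / t)"
      proof -
        have "- x * (v * x * (- x * s) + v * x * (x * s * (1 / 2 + c * v ^ 2)) - (- x) * (- x * s))
          = x ^ 3 * (1 + v / 2 - c * v ^ 3) * s" for x v s :: real
          by (simp add: power2_eq_square power3_eq_cube field_simps)
        then show ?thesis unfolding f'_def f_def q_def .
      qed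
      finally show ?thesis by simp
    qed
    then show "t * f' t * (f t * f' t + t * f t * f'' t - t * (f' t)\<^sup>2) = 1" using qt t0 by simp
    have tf: "t * f' t / f t = - (1 / V t)" using t0 wpos[of t] v by (simp add: f'_def f_def)
    have "t / f t ^ 3 = q t / V t ^ 3"
      using w3[OF t] qpos[OF t] t0 v wpos[of t] by (simp add: f_def power_mult_distrib)
    moreover have "t\<^sup>2 * (f' t)\<^sup>2 / (2 * (f t)\<^sup>2) = (t * f' t / f t)\<^sup>2 / 2"
      by (simp add: power_mult_distrib power_divide)
    moreover have "t ^ 3 * f' t ^ 3 / f t ^ 3 = (t * f' t / f t) ^ 3"
      by (simp add: power_mult_distrib power_divide)
    ultimately have "- (t / f t ^ 3) + t\<^sup>2 * (f' t)\<^sup>2 / (2 * (f t)\<^sup>2) - t ^ 3 * f' t ^ 3 / f t ^ 3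
      = - (q t / V t ^ 3) + (1 / V t)\<^sup>2 / 2 + (1 / V t) ^ 3"
      by (simp add: tf power_divide)
    also have "\<dots> = (V t ^ 3 * c) / V t ^ 3"
      using v by (simp add: q_def power_divide divide_simps) (simp add: eval_nat_numeral algebra_simps)
    also have "\<dots> = c" using v by simp
    finally show "- (t / f t ^ 3) + t\<^sup>2 * (f' t)\<^sup>2 / (2 * (f t)\<^sup>2) - t ^ 3 * f' t ^ 3 / f t ^ 3 = c" .
  qed (fact T)
qed


section \<open>Separately holomorphic functions\<close>

lemma norm_smult_axis: "norm (\<zeta> *s axis j (1::complex)) = cmod \<zeta>"
proof -
  have "\<zeta> *s axis j (1::complex) = axis j \<zeta>" by (auto simp: vec_eq_iff axis_def)
  then show ?thesis by (simp add: norm_vec_def L2_set_def axis_def if_distrib if_distribR cong: if_cong)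
qed

definition cpartial :: "'n::finite \<Rightarrow> (complex ^ 'n \<Rightarrow> complex) \<Rightarrow> complex ^ 'n \<Rightarrow> complex" where
  "cpartial j f w = deriv (\<lambda>\<zeta>. f (w + \<zeta> *s axis j 1)) 0"

text \<open>These are the holomorphic functions of several variables (Osgood's lemma), in the form that suits
  derivatives along coordinate lines. Continuity is required so that the Cauchy estimates can be made
  uniform in the remaining variables.\<close>

definition sep_holomorphic_on :: "(complex ^ 'n::finite \<Rightarrow> complex) \<Rightarrow> (complex ^ 'n) set \<Rightarrow> bool"
    (infixl \<open>sep'_holomorphic'_on\<close> 50) where
  "f sep_holomorphic_on U \<longleftrightarrow> continuous_on U f \<and>
     (\<forall>w\<in>U. \<forall>j. (\<lambda>\<zeta>. f (w + \<zeta> *s axis j 1)) field_differentiable at 0)"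

lemma sep_holomorphic_onD:
  assumes "f sep_holomorphic_on U"
  shows "continuous_on U f"
    and "w \<in> U \<Longrightarrow> ((\<lambda>\<zeta>. f (w + \<zeta> *s axis j 1)) has_field_derivative cpartial j f w) (at 0)"
  using assms unfolding sep_holomorphic_on_def cpartial_def
  by (auto simp: field_differentiable_derivI)

lemma sep_holomorphic_on_subset: "f sep_holomorphic_on U \<Longrightarrow> V \<subseteq> U \<Longrightarrow> f sep_holomorphic_on V"
  unfolding sep_holomorphic_on_def using continuous_on_subset by blast

lemma has_field_derivative_line:
  assumes "f sep_holomorphic_on U" "w + z *s axis j 1 \<in> U"
  shows "((\<lambda>\<zeta>. f (w + \<zeta> *s axis j 1)) has_field_derivative cpartial j f (w + z *s axis j 1)) (at z)"
proof -
  have "((\<lambda>\<zeta>. \<zeta> - z) has_field_derivative 1) (at z)"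
    by (auto intro!: derivative_eq_intros)
  from DERIV_chain2[of "\<lambda>\<zeta>. f ((w + z *s axis j 1) + \<zeta> *s axis j 1)" _ "\<lambda>\<zeta>. \<zeta> - z", OF _ this]
    sep_holomorphic_onD(2)[OF assms]
  have "((\<lambda>\<zeta>. f ((w + z *s axis j 1) + (\<zeta> - z) *s axis j 1)) has_field_derivative
      cpartial j f (w + z *s axis j 1) * 1) (at z)" by simp
  moreover have "(w + z *s axis j 1) + (\<zeta> - z) *s axis j 1 = w + \<zeta> *s axis j 1" for \<zeta>
    by (simp add: vec_eq_iff algebra_simps)
  ultimately show ?thesis by simp
qed

lemma sep_holomorphic_on_mult:
  assumes "f sep_holomorphic_on U" "g sep_holomorphic_on U"
  shows "(\<lambda>w. f w * g w) sep_holomorphic_on U"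
  using assms unfolding sep_holomorphic_on_def
  by (auto intro!: continuous_intros field_differentiable_mult)

lemma sep_holomorphic_on_diff:
  assumes "f sep_holomorphic_on U" "g sep_holomorphic_on U"
  shows "(\<lambda>w. f w - g w) sep_holomorphic_on U"
  using assms unfolding sep_holomorphic_on_def
  by (auto intro!: continuous_intros field_differentiable_diff)

lemma sep_holomorphic_on_divide:
  assumes "f sep_holomorphic_on U" "g sep_holomorphic_on U" "\<And>w. w \<in> U \<Longrightarrow> g w \<noteq> 0"
  shows "(\<lambda>w. f w / g w) sep_holomorphic_on U"
  using assms unfolding sep_holomorphic_on_def
  by (auto intro!: continuous_intros field_differentiable_divide)

text \<open>The second derivative is bounded by Cauchy's estimate. What matters is that the constant depends on
  \<open>g\<close> only through \<open>M\<close>, so that difference quotients converge uniformly in a family.\<close>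

lemma cauchy_difference_quotient_bound:
  assumes g: "g holomorphic_on ball 0 (2 * r)" "continuous_on (cball 0 (2 * r)) g"
    and M: "\<And>z. z \<in> cball 0 (2 * r) \<Longrightarrow> cmod (g z) \<le> M"
    and r: "0 < r" and h: "h \<noteq> 0" "cmod h < r"
  shows "cmod ((g h - g 0) / h - deriv g 0) \<le> 2 * (M + 1) / r\<^sup>2 * cmod h"
proof -
  define G where "G i = (deriv ^^ i) g" for i
  have "cmod (G 0 h - (\<Sum>i\<le>1. G i 0 * (h - 0) ^ i / fact i)) \<le> (2 * (M + 1) / r\<^sup>2) * cmod (h - 0) ^ Suc 1 / fact 1"
  proof (rule complex_Taylor[of "ball 0 r"])
    fix i and x :: complex assume "x \<in> ball 0 r"
    then have x: "x \<in> ball 0 (2 * r)" using r by auto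
    have "G i holomorphic_on ball 0 (2 * r)" unfolding G_def by (intro holomorphic_higher_deriv g) auto
    then have "(G i has_field_derivative deriv (G i) x) (at x)"
      using x by (intro holomorphic_derivI[of _ "ball 0 (2 * r)"]) auto
    then show "(G i has_field_derivative G (Suc i) x) (at x within ball 0 r)"
      by (simp add: G_def has_field_derivative_at_within)
  next
    fix x :: complex assume x: "x \<in> ball 0 r"
    have "cmod z \<le> cmod x + dist x z" for z
      using norm_triangle_ineq4[of x "x - z"] by (simp add: dist_norm)
    then have sub: "cball x r \<subseteq> cball 0 (2 * r)" "ball x r \<subseteq> ball 0 (2 * r)"
      using x by (auto simp: subset_iff) (smt (verit))+
    have "cmod ((deriv ^^ 2) g x) \<le> fact 2 * (M + 1) / r ^ 2"
    proof (rule Cauchy_higher_deriv_bound[of g x r 0])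
      show "g holomorphic_on ball x r" "continuous_on (cball x r) g"
        using g sub holomorphic_on_subset continuous_on_subset by blast+
      show "g w \<in> ball 0 (M + 1)" if "w \<in> ball x r" for w
        using M[of w] that sub ball_subset_cball[of x r] by force
    qed (use r in auto)
    then show "cmod (G (Suc 1) x) \<le> 2 * (M + 1) / r\<^sup>2" by (simp add: G_def numeral_2_eq_2)
  qed (use r h in auto)
  then have *: "cmod (g h - g 0 - deriv g 0 * h) \<le> (2 * (M + 1) / r\<^sup>2) * cmod h * cmod h"
    by (simp add: G_def power2_eq_square algebra_simps)
  have "cmod ((g h - g 0) / h - deriv g 0) = cmod (g h - g 0 - deriv g 0 * h) / cmod h"
    using h(1) by (simp add: field_simps flip: norm_divide)
  also have "\<dots> \<le> (2 * (M + 1) / r\<^sup>2) * cmod h * cmod h / cmod h"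
    using * by (rule divide_right_mono) simp
  finally show ?thesis using h(1) by simp
qed

text \<open>The derivative in direction \<open>j\<close> is a locally uniform limit of difference quotients, each of which is
  continuous and separately holomorphic; both properties survive such limits.\<close>

lemma sep_holomorphic_on_cpartial:
  assumes U: "open U" and f: "f sep_holomorphic_on U"
  shows "cpartial j f sep_holomorphic_on U"
proof -
  have "isCont (cpartial j f) w0 \<and> (\<forall>k. (\<lambda>\<zeta>. cpartial j f (w0 + \<zeta> *s axis k 1)) field_differentiable at 0)"
    if w0: "w0 \<in> U" for w0
  proof -
    obtain R where R: "0 < R" "cball w0 R \<subseteq> U" using U w0 open_contains_cball by blast
    \<comment> \<open>base points range over radius \<open>r\<close>, and circles of radius \<open>2 r\<close> about them must stay inside\<close>
    define r where "r = R / 3"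
    have r: "0 < r" "cball w0 (3 * r) \<subseteq> U" using R by (auto simp: r_def)
    have contf: "continuous_on (cball w0 (3 * r)) f"
      using continuous_on_subset[OF sep_holomorphic_onD(1)[OF f] r(2)] .
    then have "bounded (f ` cball w0 (3 * r))"
      by (intro compact_imp_bounded compact_continuous_image) auto
    then obtain M where M: "\<And>w. w \<in> cball w0 (3 * r) \<Longrightarrow> cmod (f w) \<le> M"
      unfolding bounded_iff by blast
    define B where "B = 2 * (M + 1) / r\<^sup>2"
    have line: "w + z *s axis k 1 \<in> cball w0 (s + t)" if "w \<in> cball w0 s" "cmod z \<le> t" for w z k s t
    proof -
      have "dist w0 (w + z *s axis k 1) \<le> dist w0 w + cmod z"
        using dist_triangle[of w0 "w + z *s axis k 1" w] by (simp add: dist_norm norm_smult_axis)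
      then show ?thesis using that by simp
    qed
    define h where "h n = r / (real n + 2)" for n
    define F where "F n w = (f (w + complex_of_real (h n) *s axis j 1) - f w) / complex_of_real (h n)" for n w
    have h: "0 < h n" "h n < r" for n
      using r(1) by (auto simp: h_def divide_less_eq)
    have hn: "complex_of_real (h n) \<noteq> 0" "cmod (complex_of_real (h n)) < r" for n
      using h(1)[of n] h(2)[of n] by auto
    have bound: "cmod (F n w - cpartial j f w) \<le> B * (h n)" if w: "w \<in> cball w0 r" for n w
    proof -
      define g where "g \<zeta> = f (w + \<zeta> *s axis j 1)" for \<zeta>
      have in3: "w + z *s axis j 1 \<in> cball w0 (3 * r)" if "z \<in> cball 0 (2 * r)" for z
        using line[OF w, of z "2 * r"] that by (simp add: algebra_simps)
      have D: "(g has_field_derivative cpartial j f (w + z *s axis j 1)) (at z)" if "z \<in> cball 0 (2 * r)" for z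
        unfolding g_def using has_field_derivative_line[OF f] in3[OF that] r(2) by blast
      have "cmod ((g (complex_of_real (h n)) - g 0) / complex_of_real (h n) - deriv g 0)
          \<le> 2 * (M + 1) / r\<^sup>2 * cmod (complex_of_real (h n))"
      proof (rule cauchy_difference_quotient_bound[OF _ _ _ r(1) hn])
        have "\<exists>d. (g has_field_derivative d) (at z)" if "z \<in> ball 0 (2 * r)" for z
          using D that ball_subset_cball by blast
        then show "g holomorphic_on ball 0 (2 * r)"
          by (simp add: holomorphic_on_open)
        have "isCont g z" if "z \<in> cball 0 (2 * r)" for z
          using D[OF that] by (rule DERIV_isCont)
        then show "continuous_on (cball 0 (2 * r)) g"
          by (simp add: continuous_at_imp_continuous_on)
        show "cmod (g z) \<le> M" if "z \<in> cball 0 (2 * r)" for z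
          unfolding g_def by (rule M[OF in3[OF that]])
      qed
      moreover have "cmod (complex_of_real (h n)) = h n"
        using h(1)[of n] by simp
      moreover have "deriv g 0 = cpartial j f w" "g 0 = f w"
        by (simp_all add: g_def[abs_def] cpartial_def)
      ultimately show ?thesis by (simp add: B_def F_def g_def)
    qed
    have ul: "uniform_limit (cball w0 r) F (cpartial j f) sequentially"
    proof (rule uniform_limitI)
      fix e :: real assume e: "0 < e"
      have "(\<lambda>n. B * (h n)) \<longlonglongrightarrow> 0" unfolding h_def by real_asymp
      then have "\<forall>\<^sub>F n in sequentially. B * (h n) < e"
        using e by (rule order_tendstoD)
      then show "\<forall>\<^sub>F n in sequentially. \<forall>w\<in>cball w0 r. dist (F n w) (cpartial j f w) < e"
      proof eventually_elim
        case (elim n)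
        show ?case
        proof
          fix w assume "w \<in> cball w0 r"
          from bound[OF this, of n] elim show "dist (F n w) (cpartial j f w) < e"
            unfolding dist_norm by (rule le_less_trans)
        qed
      qed
    qed
    have contF: "continuous_on (cball w0 r) (F n)" for n
    proof -
      have "continuous_on (cball w0 r) (\<lambda>w. f (w + complex_of_real (h n) *s axis j 1))"
      proof (rule continuous_on_compose2[OF contf])
        show "(\<lambda>w. w + complex_of_real (h n) *s axis j 1) ` cball w0 r \<subseteq> cball w0 (3 * r)"
        proof
          fix x assume "x \<in> (\<lambda>w. w + complex_of_real (h n) *s axis j 1) ` cball w0 r"
          then have "x \<in> cball w0 (r + r)" using line[OF _ less_imp_le[OF hn(2)[of n]]] by blast
          then show "x \<in> cball w0 (3 * r)" using r(1) by simp
        qed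
      qed (intro continuous_intros)
      moreover have "continuous_on (cball w0 r) f"
        using r(1) by (intro continuous_on_subset[OF contf]) auto
      ultimately show ?thesis unfolding F_def using hn(1)
        by (intro continuous_on_divide continuous_on_diff continuous_on_const) auto
    qed
    have "continuous_on (cball w0 r) (cpartial j f)"
      by (rule uniform_limit_theorem[OF _ ul]) (simp_all add: contF)
    then have "isCont (cpartial j f) w0"
      using r(1) by (simp add: continuous_on_interior)
    moreover have "(\<lambda>\<zeta>. cpartial j f (w0 + \<zeta> *s axis k 1)) field_differentiable at 0" for k
    proof -
      have sub: "(\<lambda>\<zeta>. w0 + \<zeta> *s axis k 1) ` cball 0 r \<subseteq> cball w0 r"
        using line[of w0 0 _ r] by auto
      have ul': "uniform_limit (cball 0 r) (\<lambda>n \<zeta>. F n (w0 + \<zeta> *s axis k 1))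
          (\<lambda>\<zeta>. cpartial j f (w0 + \<zeta> *s axis k 1)) sequentially"
        using uniform_limit_on_subset[OF ul sub] unfolding uniform_limit_iff by simp
      have "continuous_on (cball 0 r) (\<lambda>\<zeta>. F n (w0 + \<zeta> *s axis k 1))" for n
      proof (rule continuous_on_compose2[OF contF _ sub])
        have "continuous_on (cball 0 r) (\<lambda>x. \<chi> i. w0 $ i + x * axis k 1 $ i)"
          by (intro continuous_intros)
        moreover have "(\<chi> i. w0 $ i + x * axis k 1 $ i) = w0 + x *s axis k 1" for x
          by (simp add: vec_eq_iff)
        ultimately show "continuous_on (cball 0 r) (\<lambda>x. w0 + x *s axis k 1)" by (simp only:)
      qed
      moreover have "(\<lambda>\<zeta>. F n (w0 + \<zeta> *s axis k 1)) holomorphic_on ball 0 r" for n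
      proof -
        have D: "(\<lambda>\<zeta>. f (w + \<zeta> *s axis k 1)) holomorphic_on ball 0 r" if w: "w \<in> cball w0 r" for w
        proof -
          have "w + z *s axis k 1 \<in> U" if "z \<in> ball 0 r" for z
            using line[OF w, of z r k] that r by (auto simp: subset_iff)
          from has_field_derivative_line[OF f this] show ?thesis
            unfolding holomorphic_on_open[OF open_ball] by blast
        qed
        have "w0 + complex_of_real (h n) *s axis j 1 \<in> cball w0 r"
          using line[of w0 0 "complex_of_real (h n)" r] hn(2)[of n] by simp
        note D1 = D[OF this]
        have D2: "(\<lambda>\<zeta>. f (w0 + \<zeta> *s axis k 1)) holomorphic_on ball 0 r"
          using D[of w0] r(1) by simp
        show ?thesis unfolding F_def
          using holomorphic_on_divide[OF holomorphic_on_diff[OF D1 D2] holomorphic_on_const[of "complex_of_real (h n)"]] hn(1)[of n]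
          by (simp add: add_ac)
      qed
      ultimately have "\<forall>\<^sub>F n in sequentially. continuous_on (cball 0 r) (\<lambda>\<zeta>. F n (w0 + \<zeta> *s axis k 1)) \<and>
          (\<lambda>\<zeta>. F n (w0 + \<zeta> *s axis k 1)) holomorphic_on ball 0 r"
        by (intro always_eventually allI conjI)
      then have "(\<lambda>\<zeta>. cpartial j f (w0 + \<zeta> *s axis k 1)) holomorphic_on ball 0 r"
        by (rule holomorphic_uniform_limit[OF _ ul' trivial_limit_sequentially])
      then show ?thesis
        using r(1) by (auto intro: holomorphic_on_imp_differentiable_at[of _ "ball 0 r"])
    qed
    ultimately show ?thesis by blast
  qed
  then show ?thesis unfolding sep_holomorphic_on_def
    by (auto intro: continuous_at_imp_continuous_on)
qed


section \<open>Wirtinger derivatives along a complex line\<close>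

text \<open>Real differentiability of the restriction to the complex line in direction \<open>j\<close>, with the real-linear
  derivative written in terms of \<open>h\<close> and \<open>cnj h\<close>: the coefficients \<open>a\<close> and \<open>b\<close> are the two Wirtinger
  derivatives, and the usual derivative rules apply to both at once.\<close>

definition wirtinger ::
    "'n::finite \<Rightarrow> (complex ^ 'n \<Rightarrow> complex) \<Rightarrow> complex ^ 'n \<Rightarrow> complex \<Rightarrow> complex \<Rightarrow> bool" where
  "wirtinger j F w a b \<longleftrightarrow>
     ((\<lambda>\<zeta>. F (w + \<zeta> *s axis j 1)) has_derivative (\<lambda>h. a * h + b * cnj h)) (at 0)"

lemma wirtinger_partial_along:
  assumes "wirtinger j F w a b"
  shows "partial_along (axis j x) F w = a * x + b * cnj x"
proof -
  have "((\<lambda>t. complex_of_real t * x) has_derivative (\<lambda>t. complex_of_real t * x)) (at 0)"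
    by (auto intro!: derivative_eq_intros)
  moreover have "((\<lambda>\<zeta>. F (w + \<zeta> *s axis j 1)) has_derivative (\<lambda>h. a * h + b * cnj h)) (at (complex_of_real 0 * x))"
    using assms by (simp add: wirtinger_def)
  ultimately have "((\<lambda>t. F (w + (complex_of_real t * x) *s axis j 1)) has_derivative
      (\<lambda>t. a * (complex_of_real t * x) + b * cnj (complex_of_real t * x))) (at 0)"
    by (rule has_derivative_compose)
  moreover have "(complex_of_real t * x) *s axis j 1 = t *\<^sub>R axis j x" for t
    unfolding vec_eq_iff vector_scaleR_component vector_smult_component
    by (simp add: axis_def scaleR_conv_of_real)
  moreover have "(\<lambda>t. a * (complex_of_real t * x) + b * cnj (complex_of_real t * x)) =
      (\<lambda>t. t *\<^sub>R (a * x + b * cnj x))"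
    by (simp add: scaleR_conv_of_real algebra_simps)
  ultimately have "((\<lambda>t. F (w + t *\<^sub>R axis j x)) has_vector_derivative a * x + b * cnj x) (at 0)"
    unfolding has_vector_derivative_def by (simp only:)
  then show ?thesis unfolding partial_along_def by (rule vector_derivative_at)
qed

lemma wirtinger_dz: "wirtinger j F w a b \<Longrightarrow> dz j F w = a"
  and wirtinger_dzbar: "wirtinger j F w a b \<Longrightarrow> dzbar j F w = b"
  unfolding dz_def dzbar_def by (simp_all add: wirtinger_partial_along algebra_simps)

lemma wirtinger_cong:
  assumes "wirtinger j F w a b" "open V" "w \<in> V" "\<And>v. v \<in> V \<Longrightarrow> F v = G v"
  shows "wirtinger j G w a b"
proof -
  define W where "W = (\<lambda>\<zeta>. w + \<zeta> *s axis j (1::complex)) -` V"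
  have "continuous_on UNIV (\<lambda>\<zeta>. \<chi> i. w $ i + \<zeta> * axis j (1::complex) $ i)"
    by (intro continuous_intros)
  moreover have "(\<chi> i. w $ i + \<zeta> * axis j 1 $ i) = w + \<zeta> *s axis j (1::complex)" for \<zeta>
    by (simp add: vec_eq_iff)
  ultimately have "continuous_on UNIV (\<lambda>\<zeta>. w + \<zeta> *s axis j (1::complex))" by (simp only:)
  then have W: "open W" unfolding W_def using assms(2) by (intro open_vimage)
  have "0 \<in> W" using assms(3) by (simp add: W_def)
  have eq: "F (w + \<zeta> *s axis j 1) = G (w + \<zeta> *s axis j 1)" if "\<zeta> \<in> W" for \<zeta>
    using assms(4) that by (simp add: W_def)
  show ?thesis
    using has_derivative_transform_within_open[OF assms(1)[unfolded wirtinger_def] W \<open>0 \<in> W\<close> eq]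
    unfolding wirtinger_def .
qed

lemma levi_eqI:
  assumes "open V" "w \<in> V" "\<And>v. v \<in> V \<Longrightarrow> wirtinger k F v (A v) (B v)" "wirtinger j B w a b"
  shows "levi F w $ j $ k = a"
proof -
  have "wirtinger j (dzbar k F) w a b"
    by (rule wirtinger_cong[OF assms(4,1,2)]) (simp add: wirtinger_dzbar[OF assms(3)])
  then show ?thesis by (simp add: levi_def wirtinger_dz)
qed

lemma wirtinger_sep_holomorphic:
  assumes "f sep_holomorphic_on U" "w \<in> U"
  shows "wirtinger j f w (cpartial j f w) 0"
  using sep_holomorphic_onD(2)[OF assms] unfolding wirtinger_def has_field_derivative_def by simp

lemma wirtinger_cnj:
  assumes "wirtinger j F w a b"
  shows "wirtinger j (\<lambda>w. cnj (F w)) w (cnj b) (cnj a)"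
  using has_derivative_cnj[OF assms[unfolded wirtinger_def]] unfolding wirtinger_def
  by (simp add: add.commute)

lemma wirtinger_add:
  assumes "wirtinger j F w a b" "wirtinger j G w a' b'"
  shows "wirtinger j (\<lambda>w. F w + G w) w (a + a') (b + b')"
  using has_derivative_add[OF assms[unfolded wirtinger_def]] unfolding wirtinger_def
  by (simp add: algebra_simps)

lemma wirtinger_sum:
  assumes "\<And>i. i \<in> I \<Longrightarrow> wirtinger j (F i) w (a i) (b i)"
  shows "wirtinger j (\<lambda>w. \<Sum>i\<in>I. F i w) w (\<Sum>i\<in>I. a i) (\<Sum>i\<in>I. b i)"
  using has_derivative_sum[of I "\<lambda>i \<zeta>. F i (w + \<zeta> *s axis j 1)" "\<lambda>i h. a i * h + b i * cnj h" "at 0"] assms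
  unfolding wirtinger_def by (simp add: sum.distrib sum_distrib_right)

lemma wirtinger_mult:
  assumes "wirtinger j F w a b" "wirtinger j G w a' b'"
  shows "wirtinger j (\<lambda>w. F w * G w) w (F w * a' + a * G w) (F w * b' + b * G w)"
  using has_derivative_mult[OF assms[unfolded wirtinger_def]] unfolding wirtinger_def
  by (simp add: algebra_simps)

lemma wirtinger_cmult:
  assumes "wirtinger j F w a b"
  shows "wirtinger j (\<lambda>w. c * F w) w (c * a) (c * b)"
  using has_derivative_mult_right[OF assms[unfolded wirtinger_def], of c] unfolding wirtinger_def
  by (simp add: algebra_simps)

text \<open>A real-valued function has a real-valued derivative, so that multiplication by \<open>g'\<close> commutes with
  the passage between real and complex values.\<close>

lemma wirtinger_real_compose:
  assumes "wirtinger j (\<lambda>w. complex_of_real (r w)) w a b"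
    and "(g has_real_derivative g') (at (r w))"
  shows "wirtinger j (\<lambda>w. complex_of_real (g (r w))) w (g' * a) (g' * b)"
proof -
  have D: "((\<lambda>\<zeta>. complex_of_real (r (w + \<zeta> *s axis j 1))) has_derivative (\<lambda>h. a * h + b * cnj h)) (at 0)"
    using assms(1) unfolding wirtinger_def .
  have "((\<lambda>\<zeta>. Im (complex_of_real (r (w + \<zeta> *s axis j 1)))) has_derivative (\<lambda>h. Im (a * h + b * cnj h))) (at 0)"
    by (rule has_derivative_Im[OF D])
  then have "((\<lambda>\<zeta>. 0::real) has_derivative (\<lambda>h. Im (a * h + b * cnj h))) (at (0::complex))" by simp
  then have "(\<lambda>h. Im (a * h + b * cnj h)) = (\<lambda>h. 0)"
    by (rule has_derivative_unique[OF _ has_derivative_const])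
  then have re: "complex_of_real (Re (a * h + b * cnj h)) = a * h + b * cnj h" for h
    by (simp add: complex_eq_iff fun_eq_iff)
  have "((\<lambda>\<zeta>. Re (complex_of_real (r (w + \<zeta> *s axis j 1)))) has_derivative (\<lambda>h. Re (a * h + b * cnj h))) (at 0)"
    by (rule has_derivative_Re[OF D])
  then have "((\<lambda>\<zeta>. r (w + \<zeta> *s axis j 1)) has_derivative (\<lambda>h. Re (a * h + b * cnj h))) (at 0)" by simp
  moreover have "(g has_derivative (*) g') (at (r (w + 0 *s axis j 1)))"
    using assms(2) by (simp add: has_field_derivative_def)
  ultimately have "((\<lambda>\<zeta>. g (r (w + \<zeta> *s axis j 1))) has_derivative (\<lambda>h. g' * Re (a * h + b * cnj h))) (at 0)"
    by (rule has_derivative_compose)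
  then have "((\<lambda>\<zeta>. complex_of_real (g (r (w + \<zeta> *s axis j 1)))) has_derivative
      (\<lambda>h. complex_of_real (g' * Re (a * h + b * cnj h)))) (at 0)"
    by (rule has_derivative_of_real)
  then have "((\<lambda>\<zeta>. complex_of_real (g (r (w + \<zeta> *s axis j 1)))) has_derivative
      (\<lambda>h. complex_of_real g' * (a * h + b * cnj h))) (at 0)"
    by (simp only: of_real_mult re)
  then show ?thesis unfolding wirtinger_def by (simp add: algebra_simps)
qed


section \<open>The null cone in complex three-space\<close>

text \<open>The complex bilinear cross product, without conjugation: it is orthogonal to its arguments with
  respect to \<open>cdot\<close>, the form that defines the cone.\<close>

definition ccross :: "complex ^ 3 \<Rightarrow> complex ^ 3 \<Rightarrow> complex ^ 3" where
  "ccross x y = vector [x$2 * y$3 - x$3 * y$2, x$3 * y$1 - x$1 * y$3, x$1 * y$2 - x$2 * y$1]"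

definition vcnj :: "complex ^ 'n \<Rightarrow> complex ^ 'n::finite" where
  "vcnj x = (\<chi> i. cnj (x $ i))"

lemma cdot_commute: "cdot x y = cdot y x"
  by (simp add: cdot_def mult.commute)

lemma cdot_smult: "cdot (c *s x) y = c * cdot x y" "cdot x (c *s y) = c * cdot x y"
  by (simp_all add: cdot_def sum_distrib_left mult_ac)

lemma cdot_add: "cdot (x + x') y = cdot x y + cdot x' y" "cdot x (y + y') = cdot x y + cdot x y'"
  by (simp_all add: cdot_def sum.distrib algebra_simps)

lemma cdot_diff: "cdot (x - x') y = cdot x y - cdot x' y" "cdot x (y - y') = cdot x y - cdot x y'"
  by (simp_all add: cdot_def sum_subtractf algebra_simps)

lemma vcnj_simps: "vcnj (c *s x) = cnj c *s vcnj x" "vcnj (x + y) = vcnj x + vcnj y"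
  "vcnj (x - y) = vcnj x - vcnj y" "vcnj (vcnj x) = x"
  by (simp_all add: vcnj_def vec_eq_iff)

lemma cnj_cdot: "cnj (cdot x y) = cdot (vcnj x) (vcnj y)"
  by (simp add: cdot_def vcnj_def)

lemma cdot_vcnj_self: "cdot x (vcnj x) = complex_of_real ((norm x)\<^sup>2)"
  by (simp add: cdot_def vcnj_def norm_vec_def L2_set_def sum_nonneg complex_norm_square del: of_real_power)

lemma vcnj_ccross: "vcnj (ccross x y) = ccross (vcnj x) (vcnj y)"
  by (simp add: vcnj_def ccross_def vec_eq_iff forall_3)

lemma cdot_ccross_ccross: "cdot (ccross x y) (ccross z w) = cdot x z * cdot y w - cdot x w * cdot y z"
  by (simp add: cdot_def ccross_def sum_3 algebra_simps)

lemma ccross_ccross: "ccross x (ccross y z) = cdot x z *s y - cdot x y *s z"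
  by (simp add: cdot_def ccross_def vec_eq_iff forall_3 sum_3 algebra_simps)

lemma ccross_smult: "ccross x (c *s y) = c *s ccross x y"
  by (simp add: ccross_def vec_eq_iff forall_3 algebra_simps)

lemma ccross_eq_0_imp_parallel:
  fixes x y :: "complex ^ 3"
  assumes "ccross x y = 0" "x $ m \<noteq> 0"
  shows "y = (y $ m / x $ m) *s x"
proof -
  have "x $ i * y $ k = x $ k * y $ i" for i k
    using assms(1) exhaust_3[of i] exhaust_3[of k]
    by (auto simp: ccross_def vec_eq_iff forall_3)
  then have "y $ k = y $ m / x $ m * x $ k" for k
    using assms(2) by (simp add: field_simps)
  then show ?thesis unfolding vec_eq_iff vector_smult_component by blast
qed

text \<open>By the Binet-Cauchy identity the defect in this inequality is the squared norm of
  the cross product.\<close>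

lemma cauchy_schwarz_cdot:
  fixes x y :: "complex ^ 3"
  shows "(cmod (cdot x (vcnj y)))\<^sup>2 \<le> (norm x)\<^sup>2 * (norm y)\<^sup>2"
proof -
  have "complex_of_real ((norm (ccross x y))\<^sup>2) = cdot x (vcnj x) * cdot y (vcnj y) - cdot x (vcnj y) * cdot y (vcnj x)"
    by (simp only: cdot_ccross_ccross vcnj_ccross flip: cdot_vcnj_self)
  also have "cdot y (vcnj x) = cnj (cdot x (vcnj y))"
    by (simp add: cnj_cdot vcnj_simps cdot_commute)
  also have "cdot x (vcnj y) * cnj (cdot x (vcnj y)) = complex_of_real ((cmod (cdot x (vcnj y)))\<^sup>2)"
    by (rule complex_norm_square[symmetric])
  finally have "complex_of_real ((norm (ccross x y))\<^sup>2) = complex_of_real ((norm x)\<^sup>2 * (norm y)\<^sup>2 - (cmod (cdot x (vcnj y)))\<^sup>2)"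
    by (simp only: cdot_vcnj_self of_real_mult of_real_diff)
  then have "(norm (ccross x y))\<^sup>2 = (norm x)\<^sup>2 * (norm y)\<^sup>2 - (cmod (cdot x (vcnj y)))\<^sup>2"
    by (simp only: of_real_eq_iff)
  then show ?thesis by (smt (verit) zero_le_power2)
qed

text \<open>Both expressions are squared norms of vectors parallel to known ones. The first is
  that of the cross product of \<open>a\<close> and \<open>b\<close>, namely \<open>\<mu> p\<close>. The second is that of \<open>A2 a - A1 b\<close>, which
  is the cross product of \<open>vcnj p\<close> with \<open>\<mu> p\<close>; its norm is computed from \<open>cdot p p = 0\<close>.\<close>

lemma null_vector_frame:
  fixes p a b :: "complex ^ 3"
  assumes p: "cdot p p = 0" and c: "ccross a b = \<mu> *s p"
  defines "A1 \<equiv> cdot a (vcnj p)" and "A2 \<equiv> cdot b (vcnj p)"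
  shows "cdot a (vcnj a) * cdot b (vcnj b) - cdot a (vcnj b) * cdot b (vcnj a) =
      complex_of_real ((cmod \<mu>)\<^sup>2 * (norm p)\<^sup>2)"
    and "A1 * cnj A1 * cdot b (vcnj b) + A2 * cnj A2 * cdot a (vcnj a)
        - A1 * cnj A2 * cdot b (vcnj a) - A2 * cnj A1 * cdot a (vcnj b) =
      complex_of_real ((cmod \<mu>)\<^sup>2 * ((norm p)\<^sup>2)\<^sup>2)"
proof -
  have "cdot (ccross a b) (vcnj (ccross a b)) = \<mu> * cnj \<mu> * cdot p (vcnj p)"
    by (simp add: c cdot_smult vcnj_simps)
  then show "cdot a (vcnj a) * cdot b (vcnj b) - cdot a (vcnj b) * cdot b (vcnj a) =
      complex_of_real ((cmod \<mu>)\<^sup>2 * (norm p)\<^sup>2)"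
    by (simp only: vcnj_ccross cdot_ccross_ccross cdot_vcnj_self of_real_mult complex_norm_square[of \<mu>, symmetric])
  define n where "n = ccross (vcnj p) (ccross a b)"
  have n1: "n = A2 *s a - A1 *s b"
    by (simp add: n_def ccross_ccross A1_def A2_def cdot_commute)
  have n2: "n = \<mu> *s ccross (vcnj p) p"
    by (simp add: n_def c ccross_smult)
  have "cdot n (vcnj n) = A1 * cnj A1 * cdot b (vcnj b) + A2 * cnj A2 * cdot a (vcnj a)
        - A1 * cnj A2 * cdot b (vcnj a) - A2 * cnj A1 * cdot a (vcnj b)"
    by (simp add: n1 cdot_diff cdot_smult vcnj_simps algebra_simps)
  moreover have "cdot n (vcnj n) = \<mu> * cnj \<mu> * (cdot p (vcnj p))\<^sup>2"
    using p by (simp add: n2 cdot_smult vcnj_simps vcnj_ccross cdot_ccross_ccross cdot_commute power2_eq_square)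
  ultimately show "A1 * cnj A1 * cdot b (vcnj b) + A2 * cnj A2 * cdot a (vcnj a)
        - A1 * cnj A2 * cdot b (vcnj a) - A2 * cnj A1 * cdot a (vcnj b) =
      complex_of_real ((cmod \<mu>)\<^sup>2 * ((norm p)\<^sup>2)\<^sup>2)"
    by (simp only: cdot_vcnj_self of_real_mult of_real_power[of "(norm p)\<^sup>2"] complex_norm_square[of \<mu>, symmetric])
qed

text \<open>A holomorphic immersion into the null cone. Charts of the ball and charts of
  the whole cone are both of this kind, and every computation below is local.\<close>

locale kepler_chart =
  fixes U :: "(complex ^ 2) set" and \<phi> :: "complex ^ 2 \<Rightarrow> complex ^ 3"
  assumes open_U: "open U"
    and hol: "holomorphic_map_on U \<phi>"
    and inj: "w \<in> U \<Longrightarrow> inj (frechet_derivative \<phi> (at w))"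
    and in_kepler: "w \<in> U \<Longrightarrow> \<phi> w \<in> kepler"
begin

definition tangent :: "2 \<Rightarrow> complex ^ 2 \<Rightarrow> complex ^ 3" where
  "tangent j w = (\<chi> m. cpartial j (\<lambda>w. \<phi> w $ m) w)"

text \<open>The holomorphic derivative of the squared norm of \<open>\<phi>\<close>, see \<open>wirtinger_norm_sq\<close>.\<close>

definition dnorm :: "2 \<Rightarrow> complex ^ 2 \<Rightarrow> complex" where
  "dnorm j w = cdot (tangent j w) (vcnj (\<phi> w))"

lemma null: "w \<in> U \<Longrightarrow> cdot (\<phi> w) (\<phi> w) = 0" and nonzero: "w \<in> U \<Longrightarrow> \<phi> w \<noteq> 0"
  using in_kepler by (auto simp: kepler_def)

lemma derivative:
  assumes "w \<in> U"
  shows "(\<phi> has_derivative frechet_derivative \<phi> (at w)) (at w)"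
    and "frechet_derivative \<phi> (at w) (c *s v) = c *s frechet_derivative \<phi> (at w) v"
proof -
  obtain D where D: "(\<phi> has_derivative D) (at w)" "\<forall>c v. D (c *s v) = c *s D v"
    using hol assms unfolding holomorphic_map_on_def by blast
  then have "frechet_derivative \<phi> (at w) = D" using frechet_derivative_at by metis
  then show "(\<phi> has_derivative frechet_derivative \<phi> (at w)) (at w)"
    and "frechet_derivative \<phi> (at w) (c *s v) = c *s frechet_derivative \<phi> (at w) v"
    using D by auto
qed

lemma line_derivative:
  assumes "w \<in> U"
  shows "((\<lambda>\<zeta>. \<phi> (w + \<zeta> *s axis j 1) $ m) has_field_derivative
    frechet_derivative \<phi> (at w) (axis j 1) $ m) (at 0)"
proof -
  let ?D = "frechet_derivative \<phi> (at w)"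
  have "((\<lambda>\<zeta>. w + \<zeta> *s axis j 1) has_derivative (\<lambda>\<zeta>. 0 + \<zeta> *s axis j 1)) (at (0::complex))"
    by (intro has_derivative_add has_derivative_const bounded_linear_imp_has_derivative)
      (auto simp: linear_conv_bounded_linear[symmetric] linear_iff vec_eq_iff algebra_simps)
  then have "((\<lambda>\<zeta>. w + \<zeta> *s axis j 1) has_derivative (\<lambda>\<zeta>. \<zeta> *s axis j 1)) (at (0::complex))"
    by simp
  moreover have "(\<phi> has_derivative ?D) (at (w + 0 *s axis j 1))"
    using derivative(1)[OF assms] by simp
  ultimately have "((\<lambda>\<zeta>. \<phi> (w + \<zeta> *s axis j 1)) has_derivative (\<lambda>\<zeta>. ?D (\<zeta> *s axis j 1))) (at 0)"
    by (rule has_derivative_compose)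
  then have "((\<lambda>\<zeta>. \<phi> (w + \<zeta> *s axis j 1) $ m) has_derivative (\<lambda>\<zeta>. ?D (\<zeta> *s axis j 1) $ m)) (at 0)"
    by (rule bounded_linear.has_derivative[OF bounded_linear_vec_nth])
  moreover have "(\<lambda>\<zeta>. ?D (\<zeta> *s axis j 1) $ m) = (*) (?D (axis j 1) $ m)"
    by (simp add: fun_eq_iff derivative(2)[OF assms] mult.commute)
  ultimately show ?thesis unfolding has_field_derivative_def by (simp only:)
qed

lemma sep_holomorphic_component: "(\<lambda>w. \<phi> w $ m) sep_holomorphic_on U"
  unfolding sep_holomorphic_on_def
proof (intro conjI ballI allI)
  have "isCont \<phi> w" if "w \<in> U" for w
    using derivative(1)[OF that] by (rule has_derivative_continuous)
  then have "continuous_on U \<phi>" by (simp add: continuous_at_imp_continuous_on)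
  then show "continuous_on U (\<lambda>w. \<phi> w $ m)" by (intro continuous_intros)
  show "(\<lambda>\<zeta>. \<phi> (w + \<zeta> *s axis j 1) $ m) field_differentiable at 0" if "w \<in> U" for w j
    using line_derivative[OF that] unfolding field_differentiable_def by blast
qed

lemma sep_holomorphic_tangent: "(\<lambda>w. tangent j w $ m) sep_holomorphic_on U"
  using sep_holomorphic_on_cpartial[OF open_U sep_holomorphic_component]
  by (simp add: tangent_def)

lemma frechet_derivative_tangent:
  assumes "w \<in> U"
  shows "frechet_derivative \<phi> (at w) v = v $ 1 *s tangent 1 w + v $ 2 *s tangent 2 w"
proof -
  have T: "frechet_derivative \<phi> (at w) (axis j 1) = tangent j w" for j
    using DERIV_imp_deriv[OF line_derivative[OF assms]]
    by (simp add: tangent_def cpartial_def vec_eq_iff)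
  have "v = v $ 1 *s axis 1 1 + v $ 2 *s axis 2 1"
    using basis_expansion[of v] by (simp add: sum_2)
  then have "frechet_derivative \<phi> (at w) v = frechet_derivative \<phi> (at w) (v $ 1 *s axis 1 1 + v $ 2 *s axis 2 1)"
    by simp
  also have "\<dots> = frechet_derivative \<phi> (at w) (v $ 1 *s axis 1 1) + frechet_derivative \<phi> (at w) (v $ 2 *s axis 2 1)"
    using has_derivative_linear[OF derivative(1)[OF assms]] by (rule linear_add)
  finally show ?thesis by (simp add: derivative(2)[OF assms] T)
qed

lemma tangent_independent:
  assumes "w \<in> U" "x *s tangent 1 w + y *s tangent 2 w = 0"
  shows "x = 0" "y = 0"
proof -
  define v :: "complex ^ 2" where "v = vector [x, y]"
  have "frechet_derivative \<phi> (at w) v = frechet_derivative \<phi> (at w) 0"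
    using assms by (simp add: frechet_derivative_tangent v_def)
  then have "v = 0" using inj[OF assms(1)] by (simp add: inj_eq)
  then show "x = 0" "y = 0" by (auto simp: v_def vec_eq_iff forall_2)
qed

lemma ccross_tangent_nonzero:
  assumes "w \<in> U"
  shows "ccross (tangent 1 w) (tangent 2 w) \<noteq> 0"
proof
  assume 0: "ccross (tangent 1 w) (tangent 2 w) = 0"
  have "tangent 1 w \<noteq> 0" using tangent_independent[OF assms, of 1 0] by auto
  then obtain m where m: "tangent 1 w $ m \<noteq> 0" by (auto simp: vec_eq_iff)
  define x where "x = tangent 2 w $ m / tangent 1 w $ m"
  have "tangent 2 w = x *s tangent 1 w"
    unfolding x_def by (rule ccross_eq_0_imp_parallel[OF 0 m])
  then have "x *s tangent 1 w + (- 1) *s tangent 2 w = 0" by (simp add: vec_eq_iff)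
  from tangent_independent(2)[OF assms this] show False by simp
qed

lemma wirtinger_component:
  assumes "w \<in> U"
  shows "wirtinger j (\<lambda>w. \<phi> w $ m) w (tangent j w $ m) 0"
  using wirtinger_sep_holomorphic[OF sep_holomorphic_component assms] by (simp add: tangent_def)

text \<open>The derivative of the equation \<open>cdot \<phi> \<phi> = 0\<close> that defines the cone.\<close>

lemma cdot_tangent:
  assumes "w \<in> U"
  shows "cdot (\<phi> w) (tangent j w) = 0"
proof -
  have "wirtinger j (\<lambda>w. \<Sum>m\<in>UNIV. \<phi> w $ m * \<phi> w $ m) w
      (\<Sum>m\<in>UNIV. \<phi> w $ m * tangent j w $ m + tangent j w $ m * \<phi> w $ m)
      (\<Sum>m\<in>UNIV. \<phi> w $ m * 0 + 0 * \<phi> w $ m)"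
    by (intro wirtinger_sum wirtinger_mult wirtinger_component assms)
  then have "wirtinger j (\<lambda>w. 0) w
      (\<Sum>m\<in>UNIV. \<phi> w $ m * tangent j w $ m + tangent j w $ m * \<phi> w $ m)
      (\<Sum>m\<in>UNIV. \<phi> w $ m * 0 + 0 * \<phi> w $ m)"
    by (rule wirtinger_cong[OF _ open_U assms]) (use null in \<open>simp add: cdot_def\<close>)
  from wirtinger_dz[OF this] wirtinger_dz[of j "\<lambda>w. 0" w 0 0]
  have "(\<Sum>m\<in>UNIV. \<phi> w $ m * tangent j w $ m + tangent j w $ m * \<phi> w $ m) = 0"
    by (simp add: wirtinger_def)
  then show ?thesis by (simp add: cdot_def mult.commute flip: mult_2 sum_distrib_left)
qed

text \<open>Both tangent vectors are \<open>cdot\<close>-orthogonal to \<open>\<phi> w\<close>, and the iterated cross product of \<open>\<phi> w\<close> with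
  them vanishes for this reason.\<close>

lemma ccross_tangent:
  assumes "w \<in> U" "\<phi> w $ m \<noteq> 0"
  shows "ccross (tangent 1 w) (tangent 2 w) = (ccross (tangent 1 w) (tangent 2 w) $ m / \<phi> w $ m) *s \<phi> w"
  by (rule ccross_eq_0_imp_parallel[OF _ assms(2)]) (simp add: ccross_ccross cdot_tangent[OF assms(1)])

lemma wirtinger_norm_sq:
  assumes "w \<in> U"
  shows "wirtinger j (\<lambda>w. complex_of_real ((norm (\<phi> w))\<^sup>2)) w (dnorm j w) (cnj (dnorm j w))"
proof -
  have "wirtinger j (\<lambda>w. \<Sum>m\<in>UNIV. \<phi> w $ m * cnj (\<phi> w $ m)) w
      (\<Sum>m\<in>UNIV. \<phi> w $ m * cnj 0 + tangent j w $ m * cnj (\<phi> w $ m))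
      (\<Sum>m\<in>UNIV. \<phi> w $ m * cnj (tangent j w $ m) + 0 * cnj (\<phi> w $ m))"
    by (intro wirtinger_sum wirtinger_mult wirtinger_cnj wirtinger_component assms)
  moreover have "(\<lambda>w. \<Sum>m\<in>UNIV. \<phi> w $ m * cnj (\<phi> w $ m)) = (\<lambda>w. complex_of_real ((norm (\<phi> w))\<^sup>2))"
    unfolding cdot_vcnj_self[symmetric] cdot_def vcnj_def by simp
  ultimately show ?thesis
    by (simp add: dnorm_def cdot_def vcnj_def mult.commute del: of_real_power)
qed

lemma wirtinger_radial:
  assumes "w \<in> U" "(g has_real_derivative g') (at ((norm (\<phi> w))\<^sup>2))"
  shows "wirtinger j (\<lambda>w. complex_of_real (g ((norm (\<phi> w))\<^sup>2))) w (g' * dnorm j w) (g' * cnj (dnorm j w))"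
  by (rule wirtinger_real_compose[OF wirtinger_norm_sq[OF assms(1)] assms(2)])

text \<open>Only the holomorphic derivative is recorded, as the Levi form takes no other. The conjugated
  tangent vectors contribute nothing to it because they are antiholomorphic.\<close>

lemma wirtinger_cnj_dnorm:
  assumes "w \<in> U"
  shows "\<exists>b. wirtinger j (\<lambda>w. cnj (dnorm k w)) w (cdot (tangent j w) (vcnj (tangent k w))) b"
proof -
  have "wirtinger j (\<lambda>w. \<Sum>m\<in>UNIV. \<phi> w $ m * cnj (tangent k w $ m)) w
      (\<Sum>m\<in>UNIV. \<phi> w $ m * cnj 0 + tangent j w $ m * cnj (tangent k w $ m))
      (\<Sum>m\<in>UNIV. \<phi> w $ m * cnj (cpartial j (\<lambda>w. tangent k w $ m) w) + 0 * cnj (tangent k w $ m))"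
    by (intro wirtinger_sum wirtinger_mult wirtinger_cnj wirtinger_component assms
        wirtinger_sep_holomorphic[OF sep_holomorphic_tangent])
  moreover have "(\<lambda>w. \<Sum>m\<in>UNIV. \<phi> w $ m * cnj (tangent k w $ m)) = (\<lambda>w. cnj (dnorm k w))"
    by (simp add: dnorm_def cdot_def vcnj_def mult.commute)
  ultimately show ?thesis by (auto simp: cdot_def vcnj_def)
qed

end


section \<open>Radial metrics\<close>

context kepler_chart begin

abbreviation rsq :: "complex ^ 2 \<Rightarrow> real" where
  "rsq w \<equiv> (norm (\<phi> w))\<^sup>2"

lemma levi_radial:
  assumes w: "w \<in> U"
    and D1: "\<And>v. v \<in> U \<Longrightarrow> (\<Theta> has_real_derivative \<Theta>' (rsq v)) (at (rsq v))"
    and D2: "(\<Theta>' has_real_derivative \<Theta>'') (at (rsq w))"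
  shows "levi (\<lambda>v. complex_of_real (\<Theta> (rsq v))) w $ j $ k =
    \<Theta>'' * (dnorm j w * cnj (dnorm k w)) + \<Theta>' (rsq w) * cdot (tangent j w) (vcnj (tangent k w))"
proof -
  obtain b where b: "wirtinger j (\<lambda>w. cnj (dnorm k w)) w (cdot (tangent j w) (vcnj (tangent k w))) b"
    using wirtinger_cnj_dnorm[OF w] by blast
  have "levi (\<lambda>v. complex_of_real (\<Theta> (rsq v))) w $ j $ k =
      \<Theta>' (rsq w) * cdot (tangent j w) (vcnj (tangent k w)) + (\<Theta>'' * dnorm j w) * cnj (dnorm k w)"
    by (rule levi_eqI[OF open_U w wirtinger_radial[OF _ D1] wirtinger_mult[OF wirtinger_radial[OF w D2] b]])
  then show ?thesis by (simp add: mult_ac add_ac)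
qed

text \<open>The two positivity conditions are the eigenvalue conditions in the directions orthogonal and parallel
  to \<open>\<phi> w\<close>. For \<open>\<Theta>'' < 0\<close> the Cauchy-Schwarz inequality shows that the parallel direction
  is the worst one.\<close>

lemma levi_radial_pos_def:
  assumes w: "w \<in> U"
    and D1: "\<And>v. v \<in> U \<Longrightarrow> (\<Theta> has_real_derivative \<Theta>' (rsq v)) (at (rsq v))"
    and D2: "(\<Theta>' has_real_derivative \<Theta>'') (at (rsq w))"
    and pos: "0 < \<Theta>' (rsq w)" "0 < \<Theta>' (rsq w) + rsq w * \<Theta>''"
  shows "pos_def_hermitian (levi (\<lambda>v. complex_of_real (\<Theta> (rsq v))) w)"
  unfolding pos_def_hermitian_def
proof (intro allI impI)
  have levi: "levi (\<lambda>v. complex_of_real (\<Theta> (rsq v))) w $ j $ k =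
      \<Theta>'' * (dnorm j w * cnj (dnorm k w)) + \<Theta>' (rsq w) * cdot (tangent j w) (vcnj (tangent k w))" for j k
    by (rule levi_radial[OF w D1 D2])
  fix \<xi> :: "complex ^ 2" assume "\<xi> \<noteq> 0"
  define \<eta> where "\<eta> = \<xi> $ 1 *s tangent 1 w + \<xi> $ 2 *s tangent 2 w"
  have "\<eta> \<noteq> 0"
  proof
    assume "\<eta> = 0"
    then have "\<xi> $ 1 = 0" "\<xi> $ 2 = 0"
      unfolding \<eta>_def by (rule tangent_independent[OF w])+
    with \<open>\<xi> \<noteq> 0\<close> show False by (simp add: vec_eq_iff forall_2)
  qed
  define y where "y = (norm \<eta>)\<^sup>2"
  \<comment> \<open>the metric on the tangent vector \<open>\<eta>\<close> takes the value \<open>\<Theta>'' x + \<Theta>' y\<close>\<close>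
  define x where "x = (cmod (cdot \<eta> (vcnj (\<phi> w))))\<^sup>2"
  have y: "0 < y" using \<open>\<eta> \<noteq> 0\<close> by (simp add: y_def)
  have x: "0 \<le> x" "x \<le> y * rsq w"
    using cauchy_schwarz_cdot[of \<eta> "\<phi> w"] by (auto simp: x_def y_def)
  have "0 < \<Theta>'' * x + \<Theta>' (rsq w) * y"
  proof (cases "0 \<le> \<Theta>''")
    case True
    then show ?thesis using x y pos(1) by (intro add_nonneg_pos) auto
  next
    case False
    then have "\<Theta>'' * (y * rsq w) \<le> \<Theta>'' * x" using x(2) by (intro mult_left_mono_neg) auto
    moreover have "0 < (\<Theta>' (rsq w) + rsq w * \<Theta>'') * y" using pos(2) y by (rule mult_pos_pos)
    ultimately show ?thesis by (simp add: algebra_simps)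
  qed
  moreover have "(\<Sum>j\<in>UNIV. \<Sum>k\<in>UNIV. levi (\<lambda>v. complex_of_real (\<Theta> (rsq v))) w $ j $ k * \<xi> $ j * cnj (\<xi> $ k))
      = complex_of_real (\<Theta>'' * x + \<Theta>' (rsq w) * y)"
  proof -
    have "(\<Sum>j\<in>UNIV. \<Sum>k\<in>UNIV. levi (\<lambda>v. complex_of_real (\<Theta> (rsq v))) w $ j $ k * \<xi> $ j * cnj (\<xi> $ k))
      = \<Theta>'' * (cdot \<eta> (vcnj (\<phi> w)) * cnj (cdot \<eta> (vcnj (\<phi> w)))) + \<Theta>' (rsq w) * cdot \<eta> (vcnj \<eta>)"
      unfolding levi sum_2 \<eta>_def dnorm_def vcnj_simps cdot_add cdot_smult
      by (simp add: algebra_simps)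
    also have "\<dots> = complex_of_real (\<Theta>'' * x + \<Theta>' (rsq w) * y)"
      unfolding x_def y_def of_real_add of_real_mult complex_norm_square[of "cdot \<eta> (vcnj (\<phi> w))"] cdot_vcnj_self ..
    finally show ?thesis .
  qed
  ultimately show "\<exists>r>0. (\<Sum>j\<in>UNIV. \<Sum>k\<in>UNIV. levi (\<lambda>v. complex_of_real (\<Theta> (rsq v))) w $ j $ k * \<xi> $ j * cnj (\<xi> $ k))
      = complex_of_real r" by blast
qed

text \<open>The rank one part enters the determinant only linearly, so that two terms remain, and these are the two
  expressions in \<open>null_vector_frame\<close>.\<close>

lemma det_levi_radial:
  assumes w: "w \<in> U"
    and D1: "\<And>v. v \<in> U \<Longrightarrow> (\<Theta> has_real_derivative \<Theta>' (rsq v)) (at (rsq v))"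
    and D2: "(\<Theta>' has_real_derivative \<Theta>'') (at (rsq w))"
    and c: "ccross (tangent 1 w) (tangent 2 w) = \<mu> *s \<phi> w"
  shows "det (levi (\<lambda>v. complex_of_real (\<Theta> (rsq v))) w) =
    complex_of_real ((cmod \<mu>)\<^sup>2 * (rsq w * \<Theta>' (rsq w) * (\<Theta>' (rsq w) + rsq w * \<Theta>'')))"
proof -
  have levi: "levi (\<lambda>v. complex_of_real (\<Theta> (rsq v))) w $ j $ k =
      \<Theta>'' * (dnorm j w * cnj (dnorm k w)) + \<Theta>' (rsq w) * cdot (tangent j w) (vcnj (tangent k w))" for j k
    by (rule levi_radial[OF w D1 D2])
  note frame = null_vector_frame[OF null[OF w] c, folded dnorm_def]
  let ?G = "\<lambda>j k. cdot (tangent j w) (vcnj (tangent k w))" and ?A = "\<lambda>j. dnorm j w"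
  have "det (levi (\<lambda>v. complex_of_real (\<Theta> (rsq v))) w) =
      (\<Theta>' (rsq w))\<^sup>2 * (?G 1 1 * ?G 2 2 - ?G 1 2 * ?G 2 1)
      + \<Theta>' (rsq w) * \<Theta>'' * (?A 1 * cnj (?A 1) * ?G 2 2 + ?A 2 * cnj (?A 2) * ?G 1 1
        - ?A 1 * cnj (?A 2) * ?G 2 1 - ?A 2 * cnj (?A 1) * ?G 1 2)"
    unfolding det_2 levi by (simp add: power2_eq_square algebra_simps)
  also have "\<dots> = complex_of_real ((\<Theta>' (rsq w))\<^sup>2 * ((cmod \<mu>)\<^sup>2 * rsq w)
      + \<Theta>' (rsq w) * \<Theta>'' * ((cmod \<mu>)\<^sup>2 * (rsq w)\<^sup>2))"
    unfolding frame by (simp del: of_real_power add: of_real_power[of "\<Theta>' _"])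
  also have "(\<Theta>' (rsq w))\<^sup>2 * ((cmod \<mu>)\<^sup>2 * rsq w) + \<Theta>' (rsq w) * \<Theta>'' * ((cmod \<mu>)\<^sup>2 * (rsq w)\<^sup>2)
      = (cmod \<mu>)\<^sup>2 * (rsq w * \<Theta>' (rsq w) * (\<Theta>' (rsq w) + rsq w * \<Theta>''))"
    by (simp add: power2_eq_square algebra_simps)
  finally show ?thesis .
qed

text \<open>Under the differential equation \<open>ln (det g) = ln \<bar>\<mu>\<bar>\<^sup>2 + 3 \<Theta>\<close>, and the antiholomorphic derivative of
  \<open>ln \<bar>\<mu>\<bar>\<^sup>2\<close> is the conjugate of the holomorphic function \<open>\<mu>\<^sub>k / \<mu>\<close>, hence killed by the next
  holomorphic derivative.\<close>

lemma levi_ln_det_radial: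
  assumes w0: "w0 \<in> U"
    and D1: "\<And>v. v \<in> U \<Longrightarrow> (\<Theta> has_real_derivative \<Theta>' (rsq v)) (at (rsq v))"
    and D2: "\<And>v. v \<in> U \<Longrightarrow> (\<Theta>' has_real_derivative \<Theta>'' (rsq v)) (at (rsq v))"
    and ode: "\<And>v. v \<in> U \<Longrightarrow> rsq v * \<Theta>' (rsq v) * (\<Theta>' (rsq v) + rsq v * \<Theta>'' (rsq v)) = exp (3 * \<Theta> (rsq v))"
  shows "levi (\<lambda>w. ln (det (levi (\<lambda>v. complex_of_real (\<Theta> (rsq v))) w))) w0 $ j $ k =
    3 * levi (\<lambda>v. complex_of_real (\<Theta> (rsq v))) w0 $ j $ k"
proof -
  have levi: "levi (\<lambda>v. complex_of_real (\<Theta> (rsq v))) w0 $ j $ k =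
      \<Theta>'' (rsq w0) * (dnorm j w0 * cnj (dnorm k w0)) + \<Theta>' (rsq w0) * cdot (tangent j w0) (vcnj (tangent k w0))"
    by (rule levi_radial[OF w0 D1 D2[OF w0]])
  obtain m where m: "\<phi> w0 $ m \<noteq> 0" using nonzero[OF w0] by (auto simp: vec_eq_iff)
  \<comment> \<open>where this component does not vanish, \<open>\<mu>\<close> is a quotient of holomorphic functions\<close>
  define V where "V = U \<inter> (\<lambda>w. \<phi> w $ m) -` (- {0})"
  have V: "open V" unfolding V_def
    by (rule continuous_open_preimage[OF sep_holomorphic_onD(1)[OF sep_holomorphic_component] open_U]) auto
  have VU: "V \<subseteq> U" and w0V: "w0 \<in> V" using w0 m by (auto simp: V_def)
  define \<mu> where "\<mu> w = ccross (tangent 1 w) (tangent 2 w) $ m / \<phi> w $ m" for w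
  have c: "ccross (tangent 1 w) (tangent 2 w) = \<mu> w *s \<phi> w" if "w \<in> V" for w
    using ccross_tangent[of w m] that by (simp add: V_def \<mu>_def)
  have \<mu>0: "\<mu> w \<noteq> 0" if "w \<in> V" for w
    using c[OF that] ccross_tangent_nonzero[of w] that VU by auto
  have "(\<lambda>w. ccross (tangent 1 w) (tangent 2 w) $ m) sep_holomorphic_on U"
    using exhaust_3[of m]
    by (auto simp: ccross_def intro!: sep_holomorphic_on_diff sep_holomorphic_on_mult sep_holomorphic_tangent)
  then have \<mu>: "\<mu> sep_holomorphic_on V"
    unfolding \<mu>_def
    by (intro sep_holomorphic_on_divide sep_holomorphic_on_subset[OF _ VU] sep_holomorphic_component)
      (auto simp: V_def)
  define F where "F w = complex_of_real (ln ((cmod (\<mu> w))\<^sup>2)) + 3 * complex_of_real (\<Theta> (rsq w))" for w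
  have F: "ln (det (levi (\<lambda>v. complex_of_real (\<Theta> (rsq v))) w)) = F w" if w: "w \<in> V" for w
  proof -
    have wU: "w \<in> U" using w VU by auto
    have "det (levi (\<lambda>v. complex_of_real (\<Theta> (rsq v))) w) = complex_of_real ((cmod (\<mu> w))\<^sup>2 * exp (3 * \<Theta> (rsq w)))"
      unfolding ode[OF wU, symmetric] by (rule det_levi_radial[OF wU D1 D2[OF wU] c[OF w]])
    moreover have "0 < (cmod (\<mu> w))\<^sup>2" using \<mu>0[OF w] by simp
    ultimately have "ln (det (levi (\<lambda>v. complex_of_real (\<Theta> (rsq v))) w)) =
        complex_of_real (ln ((cmod (\<mu> w))\<^sup>2) + 3 * \<Theta> (rsq w))"
      by (simp add: Ln_of_real ln_mult del: of_real_mult of_real_power zero_less_power2)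
    then show ?thesis unfolding F_def by simp
  qed
  have W1: "wirtinger k F v (cpartial k \<mu> v / \<mu> v + 3 * (\<Theta>' (rsq v) * dnorm k v))
      (cnj (cpartial k \<mu> v / \<mu> v) + 3 * (\<Theta>' (rsq v) * cnj (dnorm k v)))" if v: "v \<in> V" for v
  proof -
    have vU: "v \<in> U" using v VU by auto
    have n: "(cmod (\<mu> v))\<^sup>2 \<noteq> 0" using \<mu>0[OF v] by simp
    have "wirtinger k (\<lambda>v. \<mu> v * cnj (\<mu> v)) v (\<mu> v * cnj 0 + cpartial k \<mu> v * cnj (\<mu> v))
        (\<mu> v * cnj (cpartial k \<mu> v) + 0 * cnj (\<mu> v))"
      by (intro wirtinger_mult wirtinger_cnj wirtinger_sep_holomorphic[OF \<mu> v])
    then have "wirtinger k (\<lambda>v. complex_of_real ((cmod (\<mu> v))\<^sup>2)) v (cpartial k \<mu> v * cnj (\<mu> v)) (\<mu> v * cnj (cpartial k \<mu> v))"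
      unfolding complex_norm_square by simp
    from wirtinger_real_compose[OF this DERIV_ln_divide] n
    have "wirtinger k (\<lambda>v. complex_of_real (ln ((cmod (\<mu> v))\<^sup>2))) v
       (complex_of_real (1 / (cmod (\<mu> v))\<^sup>2) * (cpartial k \<mu> v * cnj (\<mu> v)))
       (complex_of_real (1 / (cmod (\<mu> v))\<^sup>2) * (\<mu> v * cnj (cpartial k \<mu> v)))"
      by simp
    moreover have "complex_of_real (1 / (cmod (\<mu> v))\<^sup>2) = 1 / (\<mu> v * cnj (\<mu> v))"
      by (simp only: of_real_divide of_real_1 complex_norm_square)
    ultimately have "wirtinger k (\<lambda>v. complex_of_real (ln ((cmod (\<mu> v))\<^sup>2))) v (cpartial k \<mu> v / \<mu> v) (cnj (cpartial k \<mu> v / \<mu> v))"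
      using \<mu>0[OF v] by simp
    from wirtinger_add[OF this wirtinger_cmult[OF wirtinger_radial[OF vU D1[OF vU]]]]
    show ?thesis unfolding F_def .
  qed
  obtain b where b: "wirtinger j (\<lambda>w. cnj (dnorm k w)) w0 (cdot (tangent j w0) (vcnj (tangent k w0))) b"
    using wirtinger_cnj_dnorm[OF w0] by blast
  have "(\<lambda>w. cpartial k \<mu> w / \<mu> w) sep_holomorphic_on V"
    by (intro sep_holomorphic_on_divide sep_holomorphic_on_cpartial V \<mu> \<mu>0)
  from wirtinger_cnj[OF wirtinger_sep_holomorphic[OF this w0V, of j]]
  have "wirtinger j (\<lambda>v. cnj (cpartial k \<mu> v / \<mu> v) + 3 * (\<Theta>' (rsq v) * cnj (dnorm k v))) w0
      (cnj 0 + 3 * (\<Theta>' (rsq w0) * cdot (tangent j w0) (vcnj (tangent k w0)) + \<Theta>'' (rsq w0) * dnorm j w0 * cnj (dnorm k w0)))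
      (cnj (cpartial j (\<lambda>w. cpartial k \<mu> w / \<mu> w) w0) + 3 * (\<Theta>' (rsq w0) * b + \<Theta>'' (rsq w0) * cnj (dnorm j w0) * cnj (dnorm k w0)))"
    by (rule wirtinger_add[OF _ wirtinger_cmult[OF wirtinger_mult[OF wirtinger_radial[OF w0 D2[OF w0]] b]]])
  moreover have "wirtinger k (\<lambda>w. ln (det (levi (\<lambda>v. complex_of_real (\<Theta> (rsq v))) w))) v
      (cpartial k \<mu> v / \<mu> v + 3 * (\<Theta>' (rsq v) * dnorm k v))
      (cnj (cpartial k \<mu> v / \<mu> v) + 3 * (\<Theta>' (rsq v) * cnj (dnorm k v)))" if "v \<in> V" for v
    by (rule wirtinger_cong[OF W1[OF that] V that]) (simp add: F)
  ultimately have "levi (\<lambda>w. ln (det (levi (\<lambda>v. complex_of_real (\<Theta> (rsq v))) w))) w0 $ j $ k =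
      cnj 0 + 3 * (\<Theta>' (rsq w0) * cdot (tangent j w0) (vcnj (tangent k w0)) + \<Theta>'' (rsq w0) * dnorm j w0 * cnj (dnorm k w0))"
    by (intro levi_eqI[OF V w0V])
  then show ?thesis unfolding levi by (simp add: algebra_simps)
qed

text \<open>If the norm were stationary along the chart, the tangent vectors would be orthogonal to both \<open>\<phi> w\<close> and
  its conjugate. These two vectors span a complex plane, leaving only one dimension for two
  independent tangent vectors. The second identity of \<open>null_vector_frame\<close> expresses this contradiction.\<close>

lemma radial_derivative_nonzero:
  assumes w: "w \<in> U" and D: "(f has_real_derivative d) (at (rsq w))" and d: "d \<noteq> 0"
  shows "\<exists>L. ((\<lambda>w. f (rsq w)) has_derivative L) (at w) \<and> L \<noteq> (\<lambda>_. 0)"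
proof -
  let ?D = "frechet_derivative \<phi> (at w)"
  have "((\<lambda>w. rsq w) has_derivative (\<lambda>v. 2 * (\<phi> w \<bullet> ?D v))) (at w)"
    unfolding power2_norm_eq_inner
    using has_derivative_inner[OF derivative(1)[OF w] derivative(1)[OF w]]
    by (simp add: inner_commute)
  moreover have "(f has_derivative (*) d) (at (rsq w))" using D by (simp add: has_field_derivative_def)
  ultimately have L: "((\<lambda>w. f (rsq w)) has_derivative (\<lambda>v. d * (2 * (\<phi> w \<bullet> ?D v)))) (at w)"
    by (rule has_derivative_compose)
  have "(\<lambda>v. d * (2 * (\<phi> w \<bullet> ?D v))) \<noteq> (\<lambda>_. 0)"
  proof
    assume "(\<lambda>v. d * (2 * (\<phi> w \<bullet> ?D v))) = (\<lambda>_. 0)"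
    then have zero: "\<phi> w \<bullet> ?D v = 0" for v using d by (simp add: fun_eq_iff)
    have inner: "\<phi> w \<bullet> x = Re (cdot x (vcnj (\<phi> w)))" for x :: "complex ^ 3"
      by (simp add: cdot_def vcnj_def inner_vec_def inner_complex_def mult.commute)
    have T: "?D (axis j c) = c *s tangent j w" for j c
      using exhaust_2[of j] by (auto simp: frechet_derivative_tangent[OF w] axis_def)
    have dn: "dnorm j w = 0" for j
    proof -
      have "Re (c * dnorm j w) = 0" for c
        using zero[of "axis j c"] unfolding inner T by (simp add: dnorm_def cdot_smult)
      \<comment> \<open>a complex-linear form with vanishing real part is zero\<close>
      from this[of 1] this[of \<i>] show ?thesis by (simp add: complex_eq_iff)
    qed
    obtain m where m: "\<phi> w $ m \<noteq> 0" using nonzero[OF w] by (auto simp: vec_eq_iff)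
    define \<mu> where "\<mu> = ccross (tangent 1 w) (tangent 2 w) $ m / \<phi> w $ m"
    have c: "ccross (tangent 1 w) (tangent 2 w) = \<mu> *s \<phi> w"
      unfolding \<mu>_def by (rule ccross_tangent[OF w m])
    then have "\<mu> \<noteq> 0" using ccross_tangent_nonzero[OF w] by auto
    moreover have "complex_of_real ((cmod \<mu>)\<^sup>2 * (rsq w)\<^sup>2) = 0"
      using null_vector_frame(2)[OF null[OF w] c, folded dnorm_def] unfolding dn by simp
    ultimately show False using nonzero[OF w] by simp
  qed
  with L show ?thesis by blast
qed

end

lemma local_coords_image:
  assumes "local_coords S U \<phi>" "w \<in> U"
  shows "\<phi> w \<in> S"
proof -
  have "openin (top_of_set S) (\<phi> ` U)" using assms(1) by (simp add: local_coords_def)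
  then have "\<phi> ` U \<subseteq> S" by (rule openin_imp_subset)
  then show ?thesis using assms(2) by blast
qed

lemma local_coords_kepler_chart:
  assumes "local_coords S U \<phi>" "S \<subseteq> kepler"
  shows "kepler_chart U \<phi>"
proof
  show "open U" "holomorphic_map_on U \<phi>"
    using assms(1) by (simp_all add: local_coords_def)
  show "inj (frechet_derivative \<phi> (at w))" if "w \<in> U" for w
    using assms(1) that by (simp add: local_coords_def)
  show "\<phi> w \<in> kepler" if "w \<in> U" for w
    using local_coords_image[OF assms(1) that] assms(2) by blast
qed

text \<open>With \<open>\<Theta> = ln (1 / f)\<close> the differential equation becomes \<open>t \<Theta>' (\<Theta>' + t \<Theta>'') = 1 / f\<^sup>3\<close>. Its
  right-hand side is positive and so is \<open>\<Theta>'\<close>, whence \<open>\<Theta>' + t \<Theta>'' > 0\<close>: the one equation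
  accounts for the positivity of the metric as well as for its being Einstein.\<close>

lemma gives_Poincare_metric_radial:
  fixes f f' f'' :: "real \<Rightarrow> real"
  assumes T: "1 < T" and Ck: "\<And>k. Ck_on k {0<..<T} f" and f1: "f 1 = 0" "f' 1 \<noteq> 0"
    and Df: "\<And>t. t \<in> {0<..<T} \<Longrightarrow> (f has_real_derivative f' t) (at t)"
    and Df': "\<And>t. t \<in> {0<..<T} \<Longrightarrow> (f' has_real_derivative f'' t) (at t)"
    and neg: "\<And>t. t \<in> {0<..<1} \<Longrightarrow> f' t < 0"
    and pos: "\<And>t. t \<in> {0<..<1} \<Longrightarrow> 0 < f t"
    and ode: "\<And>t. t \<in> {0<..<1} \<Longrightarrow> t * f' t * (f t * f' t + t * f t * f'' t - t * (f' t)\<^sup>2) = 1"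
  shows "gives_Poincare_metric TYPE(2) (\<lambda>z :: complex ^ 3. f ((norm z)\<^sup>2))"
proof -
  have ball: "(norm z)\<^sup>2 \<in> {0<..<1}" if "z \<in> kepler_ball" for z :: "complex ^ 3"
    using that by (auto simp: kepler_ball_def kepler_def abs_square_less_1)
  have bdry: "(norm z)\<^sup>2 = 1" if "z \<in> kepler_bdry" for z :: "complex ^ 3"
    using that by (auto simp: kepler_bdry_def)
  define \<Theta> where "\<Theta> t = ln (1 / f t)" for t
  define \<Theta>' where "\<Theta>' t = - (f' t / f t)" for t
  define \<Theta>'' where "\<Theta>'' t = - ((f'' t * f t - f' t * f' t) / (f t * f t))" for t
  have \<Theta>: "(\<Theta> has_real_derivative \<Theta>' t) (at t)" and \<Theta>': "(\<Theta>' has_real_derivative \<Theta>'' t) (at t)"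
    if t: "t \<in> {0<..<1}" for t
  proof -
    have tT: "t \<in> {0<..<T}" using t T by auto
    have D: "((\<lambda>t. - ln (f t)) has_real_derivative - (1 / f t * f' t)) (at t)"
      by (rule DERIV_minus[OF DERIV_chain2[OF DERIV_ln_divide[OF pos[OF t]] Df[OF tT]]])
    then have "((\<lambda>t. - ln (f t)) has_real_derivative \<Theta>' t) (at t)" by (simp add: \<Theta>'_def)
    then show "(\<Theta> has_real_derivative \<Theta>' t) (at t)"
    proof (rule has_field_derivative_transform_within_open[OF _ open_greaterThanLessThan t])
      show "- ln (f x) = \<Theta> x" if "x \<in> {0<..<1}" for x
        using pos[OF that] by (simp add: \<Theta>_def ln_div)
    qed
    show "(\<Theta>' has_real_derivative \<Theta>'' t) (at t)"
      unfolding \<Theta>'_def \<Theta>''_def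
      by (rule DERIV_minus[OF DERIV_divide[OF Df'[OF tT] Df[OF tT]]]) (use pos[OF t] in simp)
  qed
  have K: "\<Theta>' t + t * \<Theta>'' t = - ((f t * f' t + t * f t * f'' t - t * (f' t)\<^sup>2) / (f t)\<^sup>2)"
    if "t \<in> {0<..<1}" for t
    using pos[OF that] by (simp add: \<Theta>'_def \<Theta>''_def divide_simps) (simp add: power2_eq_square algebra_simps)
  have det: "t * \<Theta>' t * (\<Theta>' t + t * \<Theta>'' t) = exp (3 * \<Theta> t)" if t: "t \<in> {0<..<1}" for t
  proof -
    have "t * \<Theta>' t * (\<Theta>' t + t * \<Theta>'' t) =
        (t * f' t * (f t * f' t + t * f t * f'' t - t * (f' t)\<^sup>2)) / f t ^ 3"
      unfolding K[OF t] by (simp add: \<Theta>'_def power2_eq_square power3_eq_cube)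
    also have "\<dots> = exp (\<Theta> t) ^ 3"
      using ode[OF t] pos[OF t] by (simp add: \<Theta>_def power_divide)
    also have "\<dots> = exp (3 * \<Theta> t)" by (simp flip: exp_of_nat_mult)
    finally show ?thesis .
  qed
  have pos1: "0 < \<Theta>' t" if "t \<in> {0<..<1}" for t
    using neg[OF that] pos[OF that] by (simp add: \<Theta>'_def divide_neg_pos)
  have pos2: "0 < \<Theta>' t + t * \<Theta>'' t" if t: "t \<in> {0<..<1}" for t
  proof -
    have "0 < (t * \<Theta>' t) * (\<Theta>' t + t * \<Theta>'' t)" using det[OF t] by simp
    moreover have "0 < t * \<Theta>' t" using pos1[OF t] t by simp
    ultimately show ?thesis by (simp only: zero_less_mult_pos)
  qed
  show ?thesis unfolding gives_Poincare_metric_def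
  proof (intro conjI allI impI ballI)
    show "smooth_on kepler_ball (\<lambda>z :: complex ^ 3. f ((norm z)\<^sup>2))"
      by (rule smooth_on_norm_sq[OF open_greaterThanLessThan Ck]) (use ball T in force)
    show "0 < f ((norm z)\<^sup>2)" if "z \<in> kepler_ball" for z :: "complex ^ 3"
      by (rule pos[OF ball[OF that]])
    show "f ((norm z)\<^sup>2) = 0" if "z \<in> kepler_bdry" for z :: "complex ^ 3"
      using bdry[OF that] f1 by simp
  next
    fix U and \<phi> :: "complex ^ 2 \<Rightarrow> complex ^ 3" and w
    assume lc: "local_coords kepler_ball U \<phi>" and w: "w \<in> U"
    interpret kepler_chart U \<phi>
      by (rule local_coords_kepler_chart[OF lc]) (auto simp: kepler_ball_def)
    have r: "(norm (\<phi> v))\<^sup>2 \<in> {0<..<1}" if "v \<in> U" for v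
      by (rule ball[OF local_coords_image[OF lc that]])
    have metric: "metric_coeffs (\<lambda>z. f ((norm z)\<^sup>2)) \<phi> = levi (\<lambda>v. complex_of_real (\<Theta> ((norm (\<phi> v))\<^sup>2)))"
      by (simp add: metric_coeffs_def \<Theta>_def)
    show "pos_def_hermitian (metric_coeffs (\<lambda>z. f ((norm z)\<^sup>2)) \<phi> w)"
      unfolding metric
      by (rule levi_radial_pos_def[OF w \<Theta>[OF r] \<Theta>'[OF r[OF w]] pos1[OF r[OF w]] pos2[OF r[OF w]]])
    show "levi (\<lambda>w'. ln (det (metric_coeffs (\<lambda>z. f ((norm z)\<^sup>2)) \<phi> w'))) w $ j $ k =
        of_nat (CARD(2) + 1) * metric_coeffs (\<lambda>z. f ((norm z)\<^sup>2)) \<phi> w $ j $ k" for j k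
    proof -
      have "levi (\<lambda>w'. ln (det (metric_coeffs (\<lambda>z. f ((norm z)\<^sup>2)) \<phi> w'))) w $ j $ k =
          3 * metric_coeffs (\<lambda>z. f ((norm z)\<^sup>2)) \<phi> w $ j $ k"
        unfolding metric by (rule levi_ln_det_radial[OF w \<Theta>[OF r] \<Theta>'[OF r] det[OF r]])
      then show ?thesis by simp
    qed
  next
    fix U and \<phi> :: "complex ^ 2 \<Rightarrow> complex ^ 3" and w
    assume lc: "local_coords kepler U \<phi>" and w: "w \<in> U" and b: "\<phi> w \<in> kepler_bdry"
    interpret kepler_chart U \<phi>
      by (rule local_coords_kepler_chart[OF lc order_refl])
    have "(f has_real_derivative f' 1) (at ((norm (\<phi> w))\<^sup>2))"
      using Df[of 1] T bdry[OF b] by simp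
    from radial_derivative_nonzero[OF w this f1(2)]
    show "\<exists>L. ((\<lambda>w'. f ((norm (\<phi> w'))\<^sup>2)) has_derivative L)
        (at w within {w' \<in> U. \<phi> w' \<in> kepler_ball \<union> kepler_bdry}) \<and> L \<noteq> (\<lambda>_. 0)"
      using has_derivative_at_withinI by blast
  qed
qed

theorem mainTheorem7:
  fixes c :: real
  assumes "0 \<le> c"
  shows "\<exists>f :: real \<Rightarrow> real.
    smooth_Ioc01 f \<and>
    (\<forall>t\<in>{0<..<1}. 0 < f t) \<and>
    f 1 = 0 \<and>
    (f has_real_derivative -1) (at 1 within {0<..1}) \<and>
    (\<forall>t\<in>{0<..<1}.
       t * deriv f t * (f t * deriv f t + t * f t * deriv (deriv f) t - t * (deriv f t)\<^sup>2) = 1) \<and>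
    (\<forall>t\<in>{0<..<1}.
       - (t / (f t) ^ 3) + t\<^sup>2 * (deriv f t)\<^sup>2 / (2 * (f t)\<^sup>2) - t ^ 3 * (deriv f t) ^ 3 / (f t) ^ 3 = c) \<and>
    gives_Poincare_metric TYPE(2) (\<lambda>z :: complex ^ 3. f ((norm z)\<^sup>2)) \<and>
    smooth_on (kepler_ball \<union> kepler_bdry) (\<lambda>z :: complex ^ 3. f ((norm z)\<^sup>2))"
proof -
  obtain T f f' f'' where T: "1 < T" and Ck: "\<And>k. Ck_on k {0<..<T} f" and f1: "f 1 = 0" "f' 1 = -1"
    and Df: "\<And>t. t \<in> {0<..<T} \<Longrightarrow> (f has_real_derivative f' t) (at t)"
    and Df': "\<And>t. t \<in> {0<..<T} \<Longrightarrow> (f' has_real_derivative f'' t) (at t)"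
    and neg: "\<And>t. t \<in> {0<..<T} \<Longrightarrow> f' t < 0"
    and pos: "\<And>t. t \<in> {0<..<1} \<Longrightarrow> 0 < f t"
    and ode: "\<And>t. t \<in> {0<..<1} \<Longrightarrow> t * f' t * (f t * f' t + t * f t * f'' t - t * (f' t)\<^sup>2) = 1"
    and int: "\<And>t. t \<in> {0<..<1} \<Longrightarrow> - (t / f t ^ 3) + t\<^sup>2 * (f' t)\<^sup>2 / (2 * (f t)\<^sup>2) - t ^ 3 * f' t ^ 3 / f t ^ 3 = c"
    by (rule exists_profile[OF assms]) blast
  have sub: "t \<in> {0<..<T}" if "t \<in> {0<..<1}" for t using that T by auto
  have d1: "deriv f t = f' t" if "t \<in> {0<..<T}" for t
    by (rule DERIV_imp_deriv[OF Df[OF that]])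
  have d2: "deriv (deriv f) t = f'' t" if t: "t \<in> {0<..<T}" for t
  proof (rule DERIV_imp_deriv)
    show "(deriv f has_real_derivative f'' t) (at t)"
      by (rule has_field_derivative_transform_within_open[OF Df'[OF t] open_greaterThanLessThan t]) (simp add: d1)
  qed
  show ?thesis
  proof (intro exI[of _ f] conjI ballI)
    show "smooth_Ioc01 f"
      by (rule smooth_Ioc01I[OF open_greaterThanLessThan _ Ck]) (use T in auto)
    show "(f has_real_derivative -1) (at 1 within {0<..1})"
      using Df[of 1] T f1(2) by (auto intro: DERIV_subset)
    show "gives_Poincare_metric TYPE(2) (\<lambda>z :: complex ^ 3. f ((norm z)\<^sup>2))"
    proof (rule gives_Poincare_metric_radial[OF T Ck f1(1) _ Df Df' neg[OF sub] pos ode])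
      show "f' 1 \<noteq> 0" using f1(2) by simp
    qed
    show "smooth_on (kepler_ball \<union> kepler_bdry) (\<lambda>z :: complex ^ 3. f ((norm z)\<^sup>2))"
    proof (rule smooth_on_norm_sq[OF open_greaterThanLessThan Ck])
      fix z :: "complex ^ 3" assume "z \<in> kepler_ball \<union> kepler_bdry"
      then have "0 < norm z" "norm z \<le> 1" by (auto simp: kepler_ball_def kepler_bdry_def kepler_def)
      then have "0 < (norm z)\<^sup>2" "(norm z)\<^sup>2 \<le> 1" by (simp_all add: power_le_one)
      then show "(norm z)\<^sup>2 \<in> {0<..<T}" using T by simp
    qed
  qed (use f1 pos ode int d1[OF sub] d2[OF sub] in simp_all)
qed

end
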